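(* Let $n\ge1$, let $K_0\subset\cdots\subset K_n$ be a tower of subfields (equalities allowed) of a finite field $K=\mathbb{F}_q$, let $d_i=|K_i|$, and let $\mathcal{X}=[K_0\times\cdots\times K_n]\subset\mathbb{P}^n$. For $1\le j\le n$ let $m_j$ be the least integer $m$ such that $m(d_j-1)>\sum_{i=1}^{j-1}(d_i-1)$. Let $j\in\{0,\ldots,n\}$, let $P=[e_j]\in\mathcal{X}$ be the point defined by the $j$-th unit vector, and let $f$ be the following indicator function of $P$: - if $j=0$: $f=t_0\prod_{i=1}^n(t_i^{d_i-1}-t_0^{d_i-1})$; - if $j=1$: $f=t_1(t_1^{d_1-1}-t_0^{d_1-1})\prod_{i=2}^n(t_i^{d_i-1}-t_1^{d_i-1})$; - if $j\ge2$: $f=t_j(f_1-f_2)\prod_{\ell=j+1}^n(t_\ell^{d_\ell-1}-t_j^{d_\ell-1})$, where $$f_1=t_j^{m_j(d_j-1)}-\sum_{i=1}^{j-1}t_i^{m_j(d_j-1)}+\sum_{s=2}^{j-1}\ \sum_{1\le j_1<\cdots<j_s\le j-1}(-1)^s\,t_{j_1}^{m_j(d_j-1)-\sum_{i=2}^s(d_{j_i}-1)}\,t_{j_2}^{d_{j_2}-1}\cdots t_{j_s}^{d_{j_s}-1},$$ $$f_2=t_0^{m_j(d_j-1)-\sum_{i=1}^{j-1}(d_i-1)}\prod_{i=1}^{j-1}(t_0^{d_i-1}-t_i^{d_i-1}).$$ Then $f$ has minimal degree among all indicator functions of $P$, and $$\mathrm{v}_P(I_{\mathcal X})=\deg(f)=\begin{cases}\mathrm{reg}(H_{\mathcal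 X})=1+\sum_{i=1}^n(d_i-1)&\text{if } j\in\{0,1\},\\ m_j(d_j-1)+1+\sum_{i=j+1}^n(d_i-1)&\text{if } j\in\{2,\ldots,n-1\},\\ m_n(d_n-1)+1&\text{if } j=n.\end{cases}$$
   Context: $S=K[t_0,\ldots,t_n]=\bigoplus_{d\ge0}S_d$ has the standard grading, and $\mathbb{P}^n$ is projective space over $K$. $\mathcal{X}=[K_0\times\cdots\times K_n]:=\{(a_0:\cdots:a_n)\in\mathbb{P}^n: a_i\in K_i\text{ for all }i\}$. An indicator function for $P\in\mathcal{X}$ is a homogeneous polynomial $f\in S$ with $f(P)\ne0$ and $f(Q)=0$ for all $Q\in\mathcal{X}\setminus\{P\}$. $I_{\mathcal X}\subset S$ is the ideal generated by the homogeneous polynomials vanishing at all points of $\mathcal{X}$, and $I_P$ is the same for the single point $P$. $H_{\mathcal X}(d):=\dim_K(S_d/(I_{\mathcal X}\cap S_d))$ and $\mathrm{reg}(H_{\mathcal X})$ is the least $r\ge0$ with $H_{\mathcal X}(d)=|\mathcal X|$ for all $d\ge r$. The local v-number is $\mathrm{v}_P(I_{\mathcal X}):=\min\{d\ge0:\exists f\in S_d\text{ with }(I_{\mathcal X}:f)=I_P\}$, where $(I_{\mathcal X}:f)=\{g\in S: gf\in I_{\mathcal X}\}$. Empty sums are $0$ and empty products are $1$. Coordinates of vectors are indexed from $0$ to $n$. When $n=1$ and $j=1$ the first and last cases of the formula agree. *)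

theory Defs
  imports "HOL-Library.Poly_Mapping" "HOL-Algebra.Algebraic_Closure_Type"
begin

section \<open>The graded polynomial ring\<close>

text \<open>
  Multivariate polynomials over \<open>K\<close> are finitely supported maps from monomials
  \<open>nat \<Rightarrow>\<^sub>0 nat\<close> (exponent of \<open>t\<^sub>i\<close> at \<open>i\<close>) to coefficients, with the convolution product of
  \<^theory>\<open>HOL-Library.Poly_Mapping\<close>. This type has countably many variables; the ring
  \<open>S = K[t\<^sub>0, \<dots>, t\<^sub>n]\<close> is the set \<open>polys n\<close>, and ideals are ideals of that subring.
\<close>

type_synonym 'a mpoly = "(nat \<Rightarrow>\<^sub>0 nat) \<Rightarrow>\<^sub>0 'a"

definition polys :: "nat \<Rightarrow> 'a::zero mpoly set" where
  "polys n = {f. \<forall>m\<in>Poly_Mapping.keys f. Poly_Mapping.keys m \<subseteq> {0..n}}"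

definition poly_ring :: "nat \<Rightarrow> 'a::comm_ring_1 mpoly ring" where
  "poly_ring n = ring_of_type_algebra\<lparr>carrier := polys n\<rparr>"

definition Const :: "'a::zero \<Rightarrow> 'a mpoly" where
  "Const c = Poly_Mapping.single 0 c"

definition Var :: "nat \<Rightarrow> 'a::zero_neq_one mpoly" where
  "Var i = Poly_Mapping.single (Poly_Mapping.single i 1) 1"

definition mon_deg :: "(nat \<Rightarrow>\<^sub>0 nat) \<Rightarrow> nat" where
  "mon_deg m = (\<Sum>i\<in>Poly_Mapping.keys m. Poly_Mapping.lookup m i)"

definition total_deg :: "'a::zero mpoly \<Rightarrow> nat" where
  "total_deg f = Max (insert 0 (mon_deg ` Poly_Mapping.keys f))"

definition graded_part :: "nat \<Rightarrow> nat \<Rightarrow> 'a::zero mpoly set" where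
  "graded_part n d = {f \<in> polys n. \<forall>m\<in>Poly_Mapping.keys f. mon_deg m = d}"

definition homogeneous :: "nat \<Rightarrow> 'a::zero mpoly \<Rightarrow> bool" where
  "homogeneous n f \<longleftrightarrow> (\<exists>d. f \<in> graded_part n d)"

definition eval_mpoly :: "'a::comm_semiring_1 mpoly \<Rightarrow> (nat \<Rightarrow> 'a) \<Rightarrow> 'a" where
  "eval_mpoly f a = (\<Sum>m\<in>Poly_Mapping.keys f. Poly_Mapping.lookup f m *
     (\<Prod>i\<in>Poly_Mapping.keys m. a i ^ Poly_Mapping.lookup m i))"


section \<open>Projective space and the set of points\<close>

text \<open>
  A vector of \<open>K\<^sup>n\<^sup>+\<^sup>1\<close> is a function on \<open>nat\<close> that is \<open>0\<close> beyond \<open>n\<close>; a point of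
  projective space is a class of nonzero vectors modulo nonzero scalars.
\<close>

definition nonzero_vecs :: "nat \<Rightarrow> (nat \<Rightarrow> 'a::zero) set" where
  "nonzero_vecs n = {a. (\<forall>i>n. a i = 0) \<and> (\<exists>i\<le>n. a i \<noteq> 0)}"

definition proj_rel :: "nat \<Rightarrow> ((nat \<Rightarrow> 'a::field) \<times> (nat \<Rightarrow> 'a)) set" where
  "proj_rel n = {(a, b). a \<in> nonzero_vecs n \<and> b \<in> nonzero_vecs n \<and>
     (\<exists>c. c \<noteq> 0 \<and> b = (\<lambda>i. c * a i))}"

definition proj_space :: "nat \<Rightarrow> (nat \<Rightarrow> 'a::field) set set" where
  "proj_space n = nonzero_vecs n // proj_rel n"

definition proj_pt :: "nat \<Rightarrow> (nat \<Rightarrow> 'a::field) \<Rightarrow> (nat \<Rightarrow> 'a) set" where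
  "proj_pt n a = proj_rel n `` {a}"

definition unit_vec :: "nat \<Rightarrow> nat \<Rightarrow> 'a::zero_neq_one" where
  "unit_vec j = (\<lambda>i. if i = j then 1 else 0)"

definition proj_product :: "nat \<Rightarrow> (nat \<Rightarrow> 'a::field set) \<Rightarrow> (nat \<Rightarrow> 'a) set set" where
  "proj_product n F = {P \<in> proj_space n. \<exists>a\<in>P. \<forall>i\<le>n. a i \<in> F i}"

text \<open>
  Only applied to homogeneous polynomials, for which vanishing does not depend on the
  representative; so \<open>f(P) \<noteq> 0\<close> is the negation.
\<close>
definition vanishes_at :: "'a::field mpoly \<Rightarrow> (nat \<Rightarrow> 'a) set \<Rightarrow> bool" where
  "vanishes_at f P \<longleftrightarrow> (\<forall>a\<in>P. eval_mpoly f a = 0)"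

definition indicator_function ::
    "nat \<Rightarrow> (nat \<Rightarrow> 'a::field) set set \<Rightarrow> (nat \<Rightarrow> 'a) set \<Rightarrow> 'a mpoly \<Rightarrow> bool" where
  "indicator_function n Xs P f \<longleftrightarrow>
     homogeneous n f \<and> \<not> vanishes_at f P \<and> (\<forall>Q\<in>Xs - {P}. vanishes_at f Q)"


section \<open>Vanishing ideals, Hilbert function and local v-number\<close>

definition vanishing_ideal :: "nat \<Rightarrow> (nat \<Rightarrow> 'a::field) set set \<Rightarrow> 'a mpoly set" where
  "vanishing_ideal n Xs =
     Idl\<^bsub>poly_ring n\<^esub> {f. homogeneous n f \<and> (\<forall>P\<in>Xs. vanishes_at f P)}"

definition colon_ideal :: "nat \<Rightarrow> 'a::field mpoly set \<Rightarrow> 'a mpoly \<Rightarrow> 'a mpoly set" where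
  "colon_ideal n I f = {g \<in> polys n. g * f \<in> I}"

text \<open>
  \<open>quot_basis V W B\<close>: \<open>B\<close> is a system of representatives of a finite \<open>K\<close>-basis of the quotient
  space \<open>V / W\<close>, i.e.\ the classes of the elements of \<open>B\<close> are pairwise distinct, linearly
  independent and spanning.
\<close>
definition quot_basis :: "'a::field mpoly set \<Rightarrow> 'a mpoly set \<Rightarrow> 'a mpoly set \<Rightarrow> bool" where
  "quot_basis V W B \<longleftrightarrow> finite B \<and> B \<subseteq> V \<and>
     (\<forall>c. (\<Sum>b\<in>B. Const (c b) * b) \<in> W \<longrightarrow> (\<forall>b\<in>B. c b = 0)) \<and>
     (\<forall>v\<in>V. \<exists>c. v - (\<Sum>b\<in>B. Const (c b) * b) \<in> W)"

definition quot_dim :: "'a::field mpoly set \<Rightarrow> 'a mpoly set \<Rightarrow> nat" where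
  "quot_dim V W = card (SOME B. quot_basis V W B)"

definition hilbert_fun :: "nat \<Rightarrow> (nat \<Rightarrow> 'a::field) set set \<Rightarrow> nat \<Rightarrow> nat" where
  "hilbert_fun n Xs d =
     quot_dim (graded_part n d) (vanishing_ideal n Xs \<inter> graded_part n d)"

definition hilbert_reg :: "nat \<Rightarrow> (nat \<Rightarrow> 'a::field) set set \<Rightarrow> nat" where
  "hilbert_reg n Xs = (LEAST r. \<forall>d\<ge>r. hilbert_fun n Xs d = card Xs)"

definition local_v_number ::
    "nat \<Rightarrow> (nat \<Rightarrow> 'a::field) set set \<Rightarrow> (nat \<Rightarrow> 'a) set \<Rightarrow> nat" where
  "local_v_number n Xs P = (LEAST d. \<exists>f\<in>graded_part n d.
     colon_ideal n (vanishing_ideal n Xs) f = vanishing_ideal n {P})"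


section \<open>The explicit indicator functions\<close>

text \<open>
  In the following, \<open>d i\<close> is the cardinality of the \<open>i\<close>-th field. The least integer
  with the defining property of \<open>m\<^sub>j\<close> is positive, so it is taken over \<open>nat\<close>; for the same reason
  none of the subtractions in exponents below truncates when the \<open>d i\<close> are at least \<open>2\<close>.
\<close>
definition m_exp :: "(nat \<Rightarrow> nat) \<Rightarrow> nat \<Rightarrow> nat" where
  "m_exp d j = (LEAST m. m * (d j - 1) > (\<Sum>i=1..j-1. d i - 1))"

text \<open>
  The inner sum over \<open>1 \<le> j\<^sub>1 < \<dots> < j\<^sub>s \<le> j - 1\<close> is indexed by the sets
  \<open>A = {j\<^sub>1, \<dots>, j\<^sub>s}\<close>, so that \<open>j\<^sub>1 = Min A\<close>.
\<close>
definition ind_f1 :: "(nat \<Rightarrow> nat) \<Rightarrow> nat \<Rightarrow> 'a::field mpoly" where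
  "ind_f1 d j = (let M = m_exp d j * (d j - 1) in
     Var j ^ M - (\<Sum>i=1..j-1. Var i ^ M)
     + (\<Sum>s=2..j-1. \<Sum>A | A \<subseteq> {1..j-1} \<and> card A = s.
          (-1) ^ s * Var (Min A) ^ (M - (\<Sum>i\<in>A - {Min A}. d i - 1))
          * (\<Prod>i\<in>A - {Min A}. Var i ^ (d i - 1))))"

definition ind_f2 :: "(nat \<Rightarrow> nat) \<Rightarrow> nat \<Rightarrow> 'a::field mpoly" where
  "ind_f2 d j =
     Var 0 ^ (m_exp d j * (d j - 1) - (\<Sum>i=1..j-1. d i - 1))
     * (\<Prod>i=1..j-1. Var 0 ^ (d i - 1) - Var i ^ (d i - 1))"

definition ind_poly :: "nat \<Rightarrow> (nat \<Rightarrow> nat) \<Rightarrow> nat \<Rightarrow> 'a::field mpoly" where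
  "ind_poly n d j =
     (if j = 0 then Var 0 * (\<Prod>i=1..n. Var i ^ (d i - 1) - Var 0 ^ (d i - 1))
      else if j = 1 then
        Var 1 * (Var 1 ^ (d 1 - 1) - Var 0 ^ (d 1 - 1))
        * (\<Prod>i=2..n. Var i ^ (d i - 1) - Var 1 ^ (d i - 1))
      else Var j * (ind_f1 d j - ind_f2 d j)
        * (\<Prod>l=j+1..n. Var l ^ (d l - 1) - Var j ^ (d l - 1)))"

end

theory Submission
  imports Defs
begin

text \<open>
  Indicator functions of \<open>P\<close> are exactly the forms \<open>f\<close> with \<open>(I : f) = I\<^sub>P\<close>, so everything reduces to
  the least degree \<open>D\<close> of an indicator function \<open>g\<close> of \<open>[e\<^sub>j]\<close>. For the lower bound, let \<open>e\<close> be the least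
  exponent with \<open>d\<^sub>j - 1\<close> dividing \<open>D + e\<close> (and \<open>e = 0\<close> if \<open>j = 0\<close>) and sum \<open>t\<^sub>j\<^sup>e g(t\<^sub>0, x)\<close> over all
  \<open>x \<in> K\<^sub>1 \<times> \<dots> \<times> K\<^sub>n\<close>. The sums for \<open>t\<^sub>0 = 0\<close> and \<open>t\<^sub>0 = 1\<close> differ, since exactly one of them sees a
  multiple of \<open>e\<^sub>j\<close>. As the power sum of a field with \<open>d\<close> elements vanishes unless the exponent is a
  positive multiple of \<open>d - 1\<close>, some monomial involves \<open>t\<^sub>0\<close> and has weighted exponent at least
  \<open>d\<^sub>i - 1\<close> in every \<open>t\<^sub>i\<close>, whence \<open>D + e \<ge> 1 + \<Sum> (d\<^sub>i - 1)\<close>; divisibility sharpens this to the claim.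

  That the given polynomials are indicator functions follows by inclusion-exclusion: on the points,
  \<open>a\<^sub>i\<close> raised to a positive multiple of \<open>d\<^sub>i - 1\<close> is the indicator of \<open>a\<^sub>i \<noteq> 0\<close>. Finally, \<open>H(d) = |X|\<close>
  holds iff every point has an indicator function of degree \<open>d\<close>, and linear substitutions
  preserving \<open>X\<close> carry the indicator functions of the \<open>[e\<^sub>k]\<close> to all points.
\<close>

section \<open>Polynomials restricted to lines\<close>

definition mon_val :: "(nat \<Rightarrow> 'a::comm_monoid_mult) \<Rightarrow> (nat \<Rightarrow>\<^sub>0 nat) \<Rightarrow> 'a" where
  "mon_val a m = (\<Prod>i\<in>Poly_Mapping.keys m. a i ^ Poly_Mapping.lookup m i)"

lemma mon_val_superset:
  assumes "finite S" "Poly_Mapping.keys m \<subseteq> S"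
  shows "mon_val a m = (\<Prod>i\<in>S. a i ^ Poly_Mapping.lookup m i)"
  unfolding mon_val_def using assms
  by (intro prod.mono_neutral_left) (auto simp: in_keys_iff)

lemma mon_val_add: "mon_val a (m + m') = mon_val a m * mon_val a m'"
proof -
  let ?S = "Poly_Mapping.keys m \<union> Poly_Mapping.keys m'"
  have "mon_val a (m + m') = (\<Prod>i\<in>?S. a i ^ Poly_Mapping.lookup (m + m') i)"
    using keys_add[of m m'] by (intro mon_val_superset) auto
  also have "\<dots> = mon_val a m * mon_val a m'"
    by (simp add: mon_val_superset[of ?S m] mon_val_superset[of ?S m'] lookup_add power_add prod.distrib)
  finally show ?thesis .
qed

lemma mon_val_zero [simp]: "mon_val a 0 = 1"
  by (simp add: mon_val_def)

lemma mon_deg_superset: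
  assumes "finite S" "Poly_Mapping.keys m \<subseteq> S"
  shows "mon_deg m = (\<Sum>i\<in>S. Poly_Mapping.lookup m i)"
  unfolding mon_deg_def using assms
  by (intro sum.mono_neutral_left) (auto simp: in_keys_iff)

lemma mon_deg_add: "mon_deg (m + m') = mon_deg m + mon_deg m'"
proof -
  let ?S = "Poly_Mapping.keys m \<union> Poly_Mapping.keys m'"
  have "mon_deg (m + m') = (\<Sum>i\<in>?S. Poly_Mapping.lookup (m + m') i)"
    using keys_add[of m m'] by (intro mon_deg_superset) auto
  also have "\<dots> = mon_deg m + mon_deg m'"
    by (simp add: mon_deg_superset[of ?S m] mon_deg_superset[of ?S m'] lookup_add sum.distrib)
  finally show ?thesis .
qed

lemma mon_deg_zero [simp]: "mon_deg 0 = 0"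
  by (simp add: mon_deg_def)

lemma mon_val_single: "mon_val a (Poly_Mapping.single i k) = a i ^ k"
  by (cases "k = 0") (auto simp: mon_val_def)

lemma mon_deg_single: "mon_deg (Poly_Mapping.single i k) = k"
  by (cases "k = 0") (auto simp: mon_deg_def)

lemma mpoly_eq_sum_single:
  fixes f :: "'a::comm_monoid_add mpoly"
  shows "f = (\<Sum>m\<in>Poly_Mapping.keys f. Poly_Mapping.single m (Poly_Mapping.lookup f m))"
  by (rule poly_mapping_eqI) (auto simp: lookup_sum lookup_single when_def in_keys_iff)

text \<open>The restriction \<open>f(a\<^sub>0 T, a\<^sub>1 T, \<dots>)\<close> of \<open>f\<close> to the line through \<open>a\<close>: its coefficients
  are the values at \<open>a\<close> of the homogeneous components of \<open>f\<close>.\<close>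

definition line_poly :: "(nat \<Rightarrow> 'a) \<Rightarrow> 'a::comm_ring_1 mpoly \<Rightarrow> 'a poly" where
  "line_poly a f =
    (\<Sum>m\<in>Poly_Mapping.keys f. monom (Poly_Mapping.lookup f m * mon_val a m) (mon_deg m))"

lemma line_poly_superset:
  assumes "finite S" "Poly_Mapping.keys f \<subseteq> S"
  shows "line_poly a f = (\<Sum>m\<in>S. monom (Poly_Mapping.lookup f m * mon_val a m) (mon_deg m))"
  unfolding line_poly_def using assms
  by (intro sum.mono_neutral_left) (auto simp: in_keys_iff)

lemma line_poly_zero [simp]: "line_poly a 0 = 0"
  by (simp add: line_poly_def)

lemma line_poly_add: "line_poly a (f + g) = line_poly a f + line_poly a g"
proof -
  let ?S = "Poly_Mapping.keys f \<union> Poly_Mapping.keys g"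
  have "line_poly a (f + g) =
      (\<Sum>m\<in>?S. monom (Poly_Mapping.lookup (f + g) m * mon_val a m) (mon_deg m))"
    using keys_add[of f g] by (intro line_poly_superset) auto
  also have "\<dots> = line_poly a f + line_poly a g"
    by (simp add: line_poly_superset[of ?S f] line_poly_superset[of ?S g]
        lookup_add distrib_right sum.distrib flip: add_monom)
  finally show ?thesis .
qed

lemma line_poly_sum: "line_poly a (sum f A) = (\<Sum>x\<in>A. line_poly a (f x))"
  by (induction A rule: infinite_finite_induct) (auto simp: line_poly_add)

lemma line_poly_single:
  "line_poly a (Poly_Mapping.single m c) = monom (c * mon_val a m) (mon_deg m)"
  by (cases "c = 0") (auto simp: line_poly_def)

text \<open>Both sides are additive in each factor, so products of single terms suffice; there the
  values multiply and the degrees add.\<close>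

lemma line_poly_mult: "line_poly a (f * g) = line_poly a f * line_poly a g"
proof -
  let ?s = "\<lambda>f m. Poly_Mapping.single m (Poly_Mapping.lookup f m)"
  have "line_poly a (f * g) = line_poly a
      ((\<Sum>m\<in>Poly_Mapping.keys f. ?s f m) * (\<Sum>m\<in>Poly_Mapping.keys g. ?s g m))"
    by (simp flip: mpoly_eq_sum_single)
  also have "\<dots> = line_poly a (\<Sum>m\<in>Poly_Mapping.keys f. ?s f m) *
      line_poly a (\<Sum>m\<in>Poly_Mapping.keys g. ?s g m)"
    by (simp add: sum_product line_poly_sum line_poly_single mult_single mon_val_add mon_deg_add
        mult_monom ac_simps)
  finally show ?thesis
    by (simp flip: mpoly_eq_sum_single)
qed

lemma line_poly_one [simp]: "line_poly a 1 = 1"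
proof -
  have "line_poly a (Poly_Mapping.single 0 1) = 1"
    unfolding line_poly_single by simp
  then show ?thesis
    by simp
qed

lemma line_poly_uminus: "line_poly a (- f) = - line_poly a f"
  using line_poly_add[of a f "- f"] by (simp add: minus_unique)

text \<open>Setting \<open>T = 1\<close> exhibits evaluation as a composition of ring homomorphisms,
  from which the evaluation rules below are inherited.\<close>

lemma eval_mpoly_conv_line_poly: "eval_mpoly f a = poly (line_poly a f) 1"
  by (simp add: eval_mpoly_def line_poly_def poly_sum poly_monom mon_val_def)

lemma eval_mpoly_altdef:
  "eval_mpoly f a = (\<Sum>m\<in>Poly_Mapping.keys f. Poly_Mapping.lookup f m * mon_val a m)"
  by (simp add: eval_mpoly_def mon_val_def)

context
  fixes a :: "nat \<Rightarrow> 'a::comm_ring_1"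
begin

lemma eval_mpoly_zero [simp]: "eval_mpoly 0 a = 0"
  and eval_mpoly_one [simp]: "eval_mpoly 1 a = 1"
  and eval_mpoly_add [simp]: "eval_mpoly (f + g) a = eval_mpoly f a + eval_mpoly g a"
  and eval_mpoly_uminus [simp]: "eval_mpoly (- f) a = - eval_mpoly f a"
  and eval_mpoly_mult [simp]: "eval_mpoly (f * g) a = eval_mpoly f a * eval_mpoly g a"
  by (simp_all add: eval_mpoly_conv_line_poly line_poly_add line_poly_mult line_poly_uminus)

lemma eval_mpoly_diff [simp]: "eval_mpoly (f - g) a = eval_mpoly f a - eval_mpoly g a"
  using eval_mpoly_add[of f "- g"] by simp

lemma eval_mpoly_power [simp]: "eval_mpoly (f ^ k) a = eval_mpoly f a ^ k"
  by (induction k) auto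

lemma eval_mpoly_sum [simp]: "eval_mpoly (sum f A) a = (\<Sum>x\<in>A. eval_mpoly (f x) a)"
  by (induction A rule: infinite_finite_induct) auto

lemma eval_mpoly_prod [simp]: "eval_mpoly (prod f A) a = (\<Prod>x\<in>A. eval_mpoly (f x) a)"
  by (induction A rule: infinite_finite_induct) auto

lemma eval_mpoly_Const [simp]: "eval_mpoly (Const c) a = c"
  by (simp add: eval_mpoly_conv_line_poly Const_def line_poly_single poly_monom)

lemma eval_mpoly_Var [simp]: "eval_mpoly (Var i) a = a i"
  by (simp add: eval_mpoly_conv_line_poly Var_def line_poly_single poly_monom mon_val_single)

end

section \<open>Closure properties of polynomials and forms\<close>

lemma graded_part_subset_polys: "graded_part n d \<subseteq> polys n"
  by (auto simp: graded_part_def)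

lemma polys_zero [simp]: "0 \<in> polys n"
  and polys_one [simp]: "(1 :: 'a::zero_neq_one mpoly) \<in> polys n"
  by (auto simp: polys_def)

lemma polys_add [intro]: "f \<in> polys n \<Longrightarrow> g \<in> polys n \<Longrightarrow> f + g \<in> polys n"
  using keys_add[of f g] by (fastforce simp: polys_def)

lemma polys_uminus [intro]: "f \<in> polys n \<Longrightarrow> - f \<in> polys n"
  by (auto simp: polys_def in_keys_iff)

lemma polys_mult [intro]:
  fixes f g :: "'a::semiring_0 mpoly"
  assumes "f \<in> polys n" "g \<in> polys n"
  shows "f * g \<in> polys n"
  unfolding polys_def
proof safe
  fix m i assume m: "m \<in> Poly_Mapping.keys (f * g)" "i \<in> Poly_Mapping.keys m"
  then obtain u v where uv: "m = u + v" "u \<in> Poly_Mapping.keys f" "v \<in> Poly_Mapping.keys g"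
    using keys_mult[of f g] by auto
  then have "i \<in> Poly_Mapping.keys u \<union> Poly_Mapping.keys v"
    using m keys_add[of u v] by auto
  with uv assms show "i \<in> {0..n}"
    unfolding polys_def by blast
qed

lemma graded_part_zero [simp]: "0 \<in> graded_part n d"
  by (auto simp: graded_part_def)

lemma graded_part_one [simp]: "(1 :: 'a::zero_neq_one mpoly) \<in> graded_part n 0"
  by (auto simp: graded_part_def)

lemma graded_part_add: "f \<in> graded_part n d \<Longrightarrow> g \<in> graded_part n d \<Longrightarrow> f + g \<in> graded_part n d"
  using keys_add[of f g] by (fastforce simp: graded_part_def)

lemma graded_part_uminus: "f \<in> graded_part n d \<Longrightarrow> - f \<in> graded_part n d"
  by (auto simp: graded_part_def in_keys_iff polys_uminus)

lemma graded_part_diff: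
  fixes f g :: "'a::ab_group_add mpoly"
  shows "f \<in> graded_part n d \<Longrightarrow> g \<in> graded_part n d \<Longrightarrow> f - g \<in> graded_part n d"
  using graded_part_add[of f n d "- g"] by (simp add: graded_part_uminus)

lemma graded_part_mult:
  fixes f g :: "'a::semiring_0 mpoly"
  assumes "f \<in> graded_part n d" "g \<in> graded_part n e"
  shows "f * g \<in> graded_part n (d + e)"
proof -
  have "mon_deg m = d + e" if "m \<in> Poly_Mapping.keys (f * g)" for m
    using that keys_mult[of f g] assms by (auto simp: graded_part_def mon_deg_add)
  then show ?thesis
    using assms by (auto simp: graded_part_def)
qed

lemma graded_part_mult':
  fixes f g :: "'a::semiring_0 mpoly"
  assumes "f \<in> graded_part n d" "g \<in> graded_part n e" "d + e = k"
  shows "f * g \<in> graded_part n k"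
  using graded_part_mult assms by blast

lemma graded_part_power:
  fixes f :: "'a::comm_semiring_1 mpoly"
  shows "f \<in> graded_part n d \<Longrightarrow> f ^ k \<in> graded_part n (k * d)"
  by (induction k) (auto intro!: graded_part_mult)

lemma graded_part_sum:
  "(\<And>x. x \<in> A \<Longrightarrow> f x \<in> graded_part n d) \<Longrightarrow> sum f A \<in> graded_part n d"
  by (induction A rule: infinite_finite_induct) (auto intro: graded_part_add)

lemma graded_part_prod:
  fixes f :: "'b \<Rightarrow> 'a::comm_semiring_1 mpoly"
  shows "finite A \<Longrightarrow> (\<And>x. x \<in> A \<Longrightarrow> f x \<in> graded_part n (d x)) \<Longrightarrow>
    prod f A \<in> graded_part n (\<Sum>x\<in>A. d x)"
  by (induction A rule: finite_induct) (auto intro: graded_part_mult)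

lemma graded_part_single:
  "Poly_Mapping.keys m \<subseteq> {0..n} \<Longrightarrow> Poly_Mapping.single m c \<in> graded_part n (mon_deg m)"
  by (cases "c = 0") (auto simp: graded_part_def polys_def)

lemma graded_part_Const: "Const c \<in> graded_part n 0"
  using graded_part_single[of 0 n c] by (simp add: Const_def)

lemma graded_part_Var: "i \<le> n \<Longrightarrow> Var i \<in> graded_part n 1"
  using graded_part_single[of "Poly_Mapping.single i 1" n 1] by (simp add: Var_def mon_deg_single)

lemma graded_part_Const_mult:
  fixes f :: "'a::semiring_0 mpoly"
  shows "f \<in> graded_part n d \<Longrightarrow> Const c * f \<in> graded_part n d"
  using graded_part_mult[OF graded_part_Const] by fastforce

lemma graded_part_Var_power:
  "i \<le> n \<Longrightarrow> (Var i :: 'a::comm_semiring_1 mpoly) ^ k \<in> graded_part n k"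
  using graded_part_power[OF graded_part_Var, of i n k] by simp

text \<open>All terms of a form have the same degree. Hence a form vanishes at \<open>a\<close>
  exactly when its \<open>line_poly\<close> is zero.\<close>

lemma line_poly_graded:
  assumes "f \<in> graded_part n d"
  shows "line_poly a f = monom (eval_mpoly f a) d"
proof -
  have "line_poly a f = (\<Sum>m\<in>Poly_Mapping.keys f. monom (Poly_Mapping.lookup f m * mon_val a m) d)"
    unfolding line_poly_def using assms by (intro sum.cong) (auto simp: graded_part_def)
  then show ?thesis
    by (simp add: eval_mpoly_altdef monom_sum)
qed

lemma mon_val_scale: "mon_val (\<lambda>i. c * a i) m = c ^ mon_deg m * mon_val a m"
  by (simp add: mon_val_def mon_deg_def power_mult_distrib prod.distrib power_sum)

lemma eval_mpoly_scale:
  assumes "f \<in> graded_part n d"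
  shows "eval_mpoly f (\<lambda>i. c * a i) = c ^ d * eval_mpoly f a"
  unfolding eval_mpoly_altdef sum_distrib_left using assms
  by (intro sum.cong) (auto simp: graded_part_def mon_val_scale ac_simps)

lemma total_deg_graded:
  assumes "f \<in> graded_part n d" "f \<noteq> 0"
  shows "total_deg f = d"
proof -
  have "Poly_Mapping.keys f \<noteq> {}"
    using assms(2) by simp
  then have "mon_deg ` Poly_Mapping.keys f = {d}"
    using assms(1) by (auto simp: graded_part_def image_constant_conv simp del: keys_eq_empty)
  then show ?thesis
    by (simp add: total_deg_def)
qed

text \<open>Replacing each variable by a linear form preserves degrees. The result is specified
  through its values, which is how changes of coordinates are used later.\<close>

lemma graded_part_substitute:
  fixes f :: "'a::comm_ring_1 mpoly"
  assumes f: "f \<in> graded_part n d" and h: "\<And>i. i \<le> n \<Longrightarrow> h i \<in> graded_part n 1"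
  shows "\<exists>g\<in>graded_part n d. \<forall>a. eval_mpoly g a = eval_mpoly f (\<lambda>i. eval_mpoly (h i) a)"
proof
  let ?g = "\<Sum>m\<in>Poly_Mapping.keys f. Const (Poly_Mapping.lookup f m) *
    (\<Prod>i\<in>Poly_Mapping.keys m. h i ^ Poly_Mapping.lookup m i)"
  show "\<forall>a. eval_mpoly ?g a = eval_mpoly f (\<lambda>i. eval_mpoly (h i) a)"
    by (simp add: eval_mpoly_def[of f])
  have "(\<Prod>i\<in>Poly_Mapping.keys m. h i ^ Poly_Mapping.lookup m i) \<in> graded_part n d"
    if m: "m \<in> Poly_Mapping.keys f" for m
  proof -
    have "(\<Prod>i\<in>Poly_Mapping.keys m. h i ^ Poly_Mapping.lookup m i) \<in>
        graded_part n (\<Sum>i\<in>Poly_Mapping.keys m. Poly_Mapping.lookup m i * 1)"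
      using m f by (intro graded_part_prod graded_part_power h) (auto simp: graded_part_def polys_def subset_iff)
    also have "(\<Sum>i\<in>Poly_Mapping.keys m. Poly_Mapping.lookup m i * 1) = d"
      using m f by (auto simp: graded_part_def mon_deg_def)
    finally show ?thesis .
  qed
  then show "?g \<in> graded_part n d"
    by (intro graded_part_sum graded_part_Const_mult)
qed

section \<open>Vanishing ideals and indicator functions\<close>

definition hom_part :: "nat \<Rightarrow> 'a::comm_ring_1 mpoly \<Rightarrow> 'a mpoly" where
  "hom_part d f = (\<Sum>m | m \<in> Poly_Mapping.keys f \<and> mon_deg m = d.
    Poly_Mapping.single m (Poly_Mapping.lookup f m))"

lemma hom_part_graded:
  assumes "f \<in> polys n"
  shows "hom_part d f \<in> graded_part n d"
  unfolding hom_part_def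
proof (rule graded_part_sum)
  fix m assume "m \<in> {m \<in> Poly_Mapping.keys f. mon_deg m = d}"
  then show "Poly_Mapping.single m (Poly_Mapping.lookup f m) \<in> graded_part n d"
    using graded_part_single[of m n] assms by (auto simp: polys_def)
qed

lemma sum_hom_part: "(\<Sum>d\<in>mon_deg ` Poly_Mapping.keys f. hom_part d f) = f"
  unfolding hom_part_def
  by (subst sum.image_gen[symmetric]) (simp_all flip: mpoly_eq_sum_single)

lemma coeff_line_poly: "coeff (line_poly a f) d =
    (\<Sum>m | m \<in> Poly_Mapping.keys f \<and> mon_deg m = d. Poly_Mapping.lookup f m * mon_val a m)"
  unfolding line_poly_def coeff_sum coeff_monom
  by (simp add: sum.If_cases Int_def)

lemma eval_hom_part: "eval_mpoly (hom_part d f) a = coeff (line_poly a f) d"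
  unfolding hom_part_def coeff_line_poly
  by (simp add: eval_mpoly_conv_line_poly line_poly_single poly_monom line_poly_sum poly_sum)

lemma poly_ring_simps [simp]:
  "carrier (poly_ring n) = polys n"
  "f \<otimes>\<^bsub>poly_ring n\<^esub> g = f * g"
  "f \<oplus>\<^bsub>poly_ring n\<^esub> g = f + g"
  "\<one>\<^bsub>poly_ring n\<^esub> = 1"
  "\<zero>\<^bsub>poly_ring n\<^esub> = 0"
  by (simp_all add: poly_ring_def ring_of_type_algebra_def)

lemma ring_poly_ring: "ring (poly_ring n :: 'a::comm_ring_1 mpoly ring)"
proof (intro ringI abelian_groupI monoidI)
  fix x :: "'a mpoly" assume "x \<in> carrier (poly_ring n)"
  then show "\<exists>y\<in>carrier (poly_ring n). y \<oplus>\<^bsub>poly_ring n\<^esub> x = \<zero>\<^bsub>poly_ring n\<^esub>"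
    by (intro bexI[of _ "- x"]) auto
qed (auto simp: algebra_simps)

text \<open>The right-hand side is an ideal since \<open>line_poly\<close> is a ring homomorphism,
  and it contains the generators. Conversely, the coefficients of \<open>line_poly a f\<close> are
  the values of the homogeneous components of \<open>f\<close>, so these components are generators.
  The values of \<open>f\<close> alone would not suffice over a field with \<open>q\<close>
  elements: \<open>t_0^q - t_0\<close> vanishes at every vector.\<close>

lemma vanishing_ideal_eq:
  fixes Xs :: "(nat \<Rightarrow> 'a::field) set set"
  shows "vanishing_ideal n Xs = {f \<in> polys n. \<forall>P\<in>Xs. \<forall>a\<in>P. line_poly a f = 0}"
    (is "_ = ?J")
proof
  let ?G = "{f. homogeneous n f \<and> (\<forall>P\<in>Xs. vanishes_at f P)}"
  let ?R = "poly_ring n :: 'a mpoly ring"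
  have "?G \<subseteq> ?J"
    using graded_part_subset_polys
    by (auto simp: homogeneous_def vanishes_at_def line_poly_graded)
  moreover have "ideal ?J ?R"
  proof (rule idealI[OF ring_poly_ring])
    interpret ring ?R
      by (rule ring_poly_ring)
    have inv: "inv\<^bsub>add_monoid ?R\<^esub> f \<in> ?J" if f: "f \<in> ?J" for f
    proof -
      have "\<ominus>\<^bsub>?R\<^esub> f = - f"
        using f by (intro minus_equality) auto
      then show ?thesis
        using f by (auto simp: a_inv_def line_poly_uminus)
    qed
    show "subgroup ?J (add_monoid ?R)"
    proof (rule subgroup.intro)
      show "inv\<^bsub>add_monoid ?R\<^esub> f \<in> ?J" if "f \<in> ?J" for f
        using that by (rule inv)
    qed (auto simp: line_poly_add)
  qed (auto simp: line_poly_mult)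
  ultimately show "vanishing_ideal n Xs \<subseteq> ?J"
    unfolding vanishing_ideal_def genideal_def by blast
  show "?J \<subseteq> vanishing_ideal n Xs"
  proof
    fix f assume f: "f \<in> ?J"
    have "f \<in> I" if I: "ideal I ?R" "?G \<subseteq> I" for I
    proof -
      interpret ideal I ?R
        by (rule I(1))
      have "hom_part d f \<in> I" for d
        using f hom_part_graded[of f n d] I(2)
        by (auto simp: homogeneous_def vanishes_at_def eval_hom_part)
      then have "(\<Sum>d\<in>A. hom_part d f) \<in> I" for A
        using additive_subgroup.zero_closed[OF is_additive_subgroup]
          additive_subgroup.a_closed[OF is_additive_subgroup]
        by (induction A rule: infinite_finite_induct) auto
      then show ?thesis
        by (metis sum_hom_part)
    qed
    then show "f \<in> vanishing_ideal n Xs"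
      unfolding vanishing_ideal_def genideal_def by blast
  qed
qed

section \<open>Points of projective space and their representatives\<close>

lemma proj_pt_eq:
  assumes "a \<in> nonzero_vecs n"
  shows "proj_pt n a = {\<lambda>i. c * a i |c. c \<noteq> 0}"
  using assms unfolding proj_pt_def proj_rel_def nonzero_vecs_def by auto

lemma mem_proj_pt: "a \<in> nonzero_vecs n \<Longrightarrow> a \<in> proj_pt n a"
  by (auto simp: proj_pt_eq intro!: exI[of _ 1])

lemma proj_pt_subset: "proj_pt n a \<subseteq> nonzero_vecs n"
  by (auto simp: proj_pt_def proj_rel_def)

lemma proj_pt_eqI:
  assumes "a \<in> nonzero_vecs n" "b \<in> proj_pt n a"
  shows "proj_pt n b = proj_pt n a"
proof -
  obtain c where c: "c \<noteq> 0" "b = (\<lambda>i. c * a i)"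
    using assms by (auto simp: proj_pt_eq)
  have b: "b \<in> nonzero_vecs n"
    using assms proj_pt_subset by blast
  have "\<exists>e. (\<lambda>i. e' * a i) = (\<lambda>i. e * b i) \<and> e \<noteq> 0" if "e' \<noteq> 0" for e'
    using that c by (intro exI[of _ "e' / c"]) auto
  moreover have "\<exists>e. (\<lambda>i. e' * b i) = (\<lambda>i. e * a i) \<and> e \<noteq> 0" if "e' \<noteq> 0" for e'
    using that c by (intro exI[of _ "e' * c"]) (auto simp: ac_simps)
  ultimately show ?thesis
    unfolding proj_pt_eq[OF assms(1)] proj_pt_eq[OF b] by blast
qed

lemma proj_space_eq: "proj_space n = proj_pt n ` nonzero_vecs n"
  by (auto simp: proj_space_def quotient_def proj_pt_def)

lemma proj_space_cases:
  assumes "P \<in> proj_space n" "a \<in> P"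
  shows "a \<in> nonzero_vecs n" "P = proj_pt n a"
  using assms proj_pt_eqI proj_pt_subset unfolding proj_space_eq by blast+

lemma proj_space_nonempty:
  assumes "P \<in> proj_space n"
  obtains a where "a \<in> P"
  using assms mem_proj_pt unfolding proj_space_eq by blast

lemma vanishes_at_iff:
  assumes "f \<in> graded_part n d" "P \<in> proj_space n" "a \<in> P"
  shows "vanishes_at f P \<longleftrightarrow> eval_mpoly f a = 0"
proof -
  have a: "a \<in> nonzero_vecs n" "P = proj_pt n a"
    using proj_space_cases assms by blast+
  then show ?thesis
    using assms(3) unfolding vanishes_at_def by (auto simp: proj_pt_eq eval_mpoly_scale[OF assms(1)])
qed

text \<open>If \<open>a k \<noteq> 0\<close>, the forms \<open>a_k t_i - a_i t_k\<close> vanish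
  simultaneously only at the multiples of \<open>a\<close>, so one of them is nonzero at any other
  point.\<close>

lemma separating_linear_form:
  assumes "P \<in> proj_space n" "Q \<in> proj_space n" "P \<noteq> Q"
  obtains h where "h \<in> graded_part n 1" "vanishes_at h P" "\<not> vanishes_at h Q"
proof -
  obtain a b where ab: "a \<in> P" "b \<in> Q"
    using assms proj_space_nonempty by metis
  note a = proj_space_cases[OF assms(1) ab(1)] and b = proj_space_cases[OF assms(2) ab(2)]
  obtain k where k: "k \<le> n" "a k \<noteq> 0"
    using a by (auto simp: nonzero_vecs_def)
  define h where "h i = Const (a k) * Var i - Const (a i) * Var k" for i
  have h: "h i \<in> graded_part n 1" if "i \<le> n" for i
    unfolding h_def using that k by (intro graded_part_diff graded_part_Const_mult graded_part_Var)
  have "\<exists>i\<le>n. eval_mpoly (h i) b \<noteq> 0"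
  proof (rule ccontr)
    assume "\<not> ?thesis"
    then have "b i = (b k / a k) * a i" for i
      using a b k by (cases "i \<le> n") (auto simp: h_def field_simps nonzero_vecs_def)
    then have eq: "b = (\<lambda>i. (b k / a k) * a i)"
      by blast
    moreover have "b k / a k \<noteq> 0"
    proof
      assume "b k / a k = 0"
      then have "b i = 0" for i
        using fun_cong[OF eq, of i] by (simp only: mult_zero_left)
      then show False
        using b(1) by (auto simp: nonzero_vecs_def)
    qed
    ultimately have "b \<in> proj_pt n a"
      unfolding proj_pt_eq[OF a(1)] by blast
    then show False
      using a b assms(3) proj_pt_eqI by blast
  qed
  then obtain i where i: "i \<le> n" "eval_mpoly (h i) b \<noteq> 0"
    by blast
  show ?thesis
  proof (rule that[OF h[OF i(1)]])
    show "vanishes_at (h i) P"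
      using vanishes_at_iff[OF h assms(1) ab(1)] i by (simp add: h_def)
    show "\<not> vanishes_at (h i) Q"
      using vanishes_at_iff[OF h assms(2) ab(2)] i by simp
  qed
qed

text \<open>Equality of the two ideals is tested on forms. The known indicator function
  \<open>h\<close> is not in the ideal of \<open>P\<close>, which forces \<open>f\<close> to be
  nonzero at \<open>P\<close>; a linear form vanishing at \<open>P\<close> but not at
  \<open>Q\<close> is in that ideal, which forces \<open>f\<close> to vanish at
  \<open>Q\<close>.\<close>

lemma colon_ideal_eq_iff_indicator:
  fixes Xs :: "(nat \<Rightarrow> 'a::field) set set"
  assumes Xs: "Xs \<subseteq> proj_space n" "P \<in> Xs" and f: "f \<in> graded_part n d"
    and h: "indicator_function n Xs P h"
  shows "colon_ideal n (vanishing_ideal n Xs) f = vanishing_ideal n {P} \<longleftrightarrow>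
    indicator_function n Xs P f"
proof
  let ?I = "vanishing_ideal n Xs"
  have fpoly: "f \<in> polys n"
    using f graded_part_subset_polys by blast
  \<comment> \<open>On the line through \<open>a\<close>, \<open>f\<close> becomes a monomial with
    coefficient \<open>f(a)\<close>, and \<open>K[T]\<close> is a domain.\<close>
  have mem_colon: "g \<in> colon_ideal n ?I f \<longleftrightarrow> g \<in> polys n \<and>
      (\<forall>Q\<in>Xs. \<forall>a\<in>Q. line_poly a g = 0 \<or> eval_mpoly f a = 0)" for g
    using fpoly by (auto simp: colon_ideal_def vanishing_ideal_eq line_poly_mult
        line_poly_graded[OF f] monom_eq_0_iff polys_mult)
  {
    assume ind: "indicator_function n Xs P f"
    then have "eval_mpoly f a = 0 \<longleftrightarrow> Q \<noteq> P" if "Q \<in> Xs" "a \<in> Q" for Q a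
      using that Xs vanishes_at_iff[OF f, of Q a] by (auto simp: indicator_function_def)
    then show "colon_ideal n ?I f = vanishing_ideal n {P}"
      using Xs(2) unfolding set_eq_iff mem_colon vanishing_ideal_eq[of n "{P}"] by blast
  next
    assume eq: "colon_ideal n ?I f = vanishing_ideal n {P}"
    obtain e where e: "h \<in> graded_part n e"
      using h by (auto simp: indicator_function_def homogeneous_def)
    have colon_graded: "g \<in> colon_ideal n ?I f \<longleftrightarrow>
        (\<forall>Q\<in>Xs. vanishes_at g Q \<or> vanishes_at f Q)" if "g \<in> graded_part n k" for g k
    proof -
      have "(\<forall>a\<in>Q. line_poly a g = 0 \<or> eval_mpoly f a = 0) \<longleftrightarrow>
          vanishes_at g Q \<or> vanishes_at f Q" if "Q \<in> Xs" for Q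
      proof -
        have Q: "Q \<in> proj_space n"
          using that Xs by blast
        obtain a where "a \<in> Q"
          using Q proj_space_nonempty by metis
        then show ?thesis
          using vanishes_at_iff[OF f Q] vanishes_at_iff[OF \<open>g \<in> graded_part n k\<close> Q]
          by (auto simp: line_poly_graded[OF \<open>g \<in> graded_part n k\<close>])
      qed
      then show ?thesis
        using that graded_part_subset_polys[of n k] by (auto simp: mem_colon)
    qed
    have van_graded: "g \<in> vanishing_ideal n {P} \<longleftrightarrow> vanishes_at g P"
      if "g \<in> graded_part n k" for g k
      using that graded_part_subset_polys[of n k]
      by (auto simp: vanishing_ideal_eq line_poly_graded vanishes_at_def)
    have "\<not> vanishes_at f P"
      using colon_graded[OF e] van_graded[OF e] eq h unfolding indicator_function_def by blast
    moreover have "vanishes_at f Q" if Q: "Q \<in> Xs - {P}" for Q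
    proof -
      obtain l where l: "l \<in> graded_part n 1" "vanishes_at l P" "\<not> vanishes_at l Q"
        using separating_linear_form[of P n Q] Q Xs by blast
      then show ?thesis
        using colon_graded[OF l(1)] van_graded[OF l(1)] eq Q by blast
    qed
    ultimately show "indicator_function n Xs P f"
      using f by (auto simp: indicator_function_def homogeneous_def)
  }
qed

lemma local_v_number_eq_Least:
  fixes Xs :: "(nat \<Rightarrow> 'a::field) set set"
  assumes "Xs \<subseteq> proj_space n" "P \<in> Xs" "indicator_function n Xs P h"
  shows "local_v_number n Xs P = (LEAST d. \<exists>f\<in>graded_part n d. indicator_function n Xs P f)"
  unfolding local_v_number_def using colon_ideal_eq_iff_indicator[OF assms(1,2) _ assms(3)]
  by (intro arg_cong[where f = Least]) blast

section \<open>Power sums over a finite subfield\<close>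

context
  fixes k :: "'a::{field,finite} set"
  assumes k: "subfield k (ring_of_type_algebra :: 'a ring)"
begin

lemma subfield_type_closed:
  shows subfield_0: "0 \<in> k" and subfield_1: "1 \<in> k"
    and subfield_add: "x \<in> k \<Longrightarrow> y \<in> k \<Longrightarrow> x + y \<in> k"
    and subfield_mult: "x \<in> k \<Longrightarrow> y \<in> k \<Longrightarrow> x * y \<in> k"
    and subfield_uminus: "x \<in> k \<Longrightarrow> - x \<in> k"
proof -
  interpret ring "ring_of_type_algebra :: 'a ring"
    by (rule ring_from_type_algebra)
  note sub = subringE[OF subfieldE(1)[OF k]]
  show "0 \<in> k" "1 \<in> k" "x \<in> k \<Longrightarrow> y \<in> k \<Longrightarrow> x + y \<in> k"
      "x \<in> k \<Longrightarrow> y \<in> k \<Longrightarrow> x * y \<in> k"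
    using sub(2,3,6,7) by (simp_all add: ring_of_type_algebra_def)
  have "\<ominus>\<^bsub>ring_of_type_algebra\<^esub> x = - x"
    by (rule minus_equality) (simp_all add: ring_of_type_algebra_def)
  then show "x \<in> k \<Longrightarrow> - x \<in> k"
    using sub(5)[of x] by simp
qed

lemma subfield_diff: "x \<in> k \<Longrightarrow> y \<in> k \<Longrightarrow> x - y \<in> k"
  using subfield_add[of x "- y"] subfield_uminus by simp

text \<open>Multiplication by a nonzero \<open>x\<close> is injective on the finite set
  \<open>k\<close>, hence surjective, and so attains 1.\<close>

lemma subfield_inverse:
  assumes "x \<in> k"
  shows "inverse x \<in> k"
proof (cases "x = 0")
  case True
  then show ?thesis
    using subfield_0 by simp
next
  case False
  have "(*) x ` k = k"
    using False assms subfield_mult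
    by (intro endo_inj_surj) (auto simp: inj_on_def)
  then obtain y where "y \<in> k" "x * y = 1"
    using subfield_1 by (metis imageE)
  then show ?thesis
    by (metis inverse_unique)
qed

lemma subfield_divide: "x \<in> k \<Longrightarrow> y \<in> k \<Longrightarrow> x / y \<in> k"
  by (simp add: divide_inverse subfield_mult subfield_inverse)

lemma card_subfield_ge_2: "card k \<ge> 2"
  using card_mono[of k "{0, 1}"] subfield_0 subfield_1 by simp

lemma bij_betw_mult_subfield:
  assumes "x \<in> k" "x \<noteq> 0"
  shows "bij_betw ((*) x) k k" and "bij_betw ((*) x) (k - {0}) (k - {0})"
proof -
  have "(*) x ` k = k"
    using assms subfield_mult by (intro endo_inj_surj) (auto simp: inj_on_def)
  then show *: "bij_betw ((*) x) k k"
    using assms by (auto simp: bij_betw_def inj_on_def)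
  show "bij_betw ((*) x) (k - {0}) (k - {0})"
    using bij_betw_DiffI[OF *, of "{0}" "{0}"] subfield_0 by (auto simp: bij_betw_def)
qed

text \<open>Multiplication by \<open>x\<close> permutes the nonzero elements of \<open>k\<close>;
  the product of all of them is compared before and after.\<close>

lemma subfield_power_card:
  assumes "x \<in> k" "x \<noteq> 0"
  shows "x ^ (card k - 1) = 1"
proof -
  have "(\<Prod>y\<in>k - {0}. y) = (\<Prod>y\<in>k - {0}. x * y)"
    using prod.reindex_bij_betw[OF bij_betw_mult_subfield(2)[OF assms], of "\<lambda>y. y"] by simp
  also have "\<dots> = x ^ (card k - 1) * (\<Prod>y\<in>k - {0}. y)"
    using subfield_0 by (simp add: prod.distrib)
  finally show ?thesis
    by auto
qed

lemma subfield_power_dvd: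
  assumes "x \<in> k" "x \<noteq> 0" "card k - 1 dvd e"
  shows "x ^ e = 1"
  using subfield_power_card[OF assms(1,2)] assms(3) by (auto simp: power_mult elim!: dvdE)

text \<open>The exponent may be reduced to its nonzero remainder \<open>r\<close> modulo
  \<open>card k - 1\<close>. The polynomial \<open>T^r - 1\<close> has at most \<open>r\<close>
  roots, fewer than there are nonzero elements.\<close>

lemma subfield_power_neq_1:
  assumes "\<not> card k - 1 dvd e"
  obtains y where "y \<in> k" "y \<noteq> 0" "y ^ e \<noteq> 1"
proof -
  define r where "r = e mod (card k - 1)"
  have r: "0 < r" "r < card k - 1"
    using assms card_subfield_ge_2 by (auto simp: r_def mod_eq_0_iff_dvd intro!: Nat.gr0I)
  have "\<exists>y\<in>k - {0}. y ^ r \<noteq> 1"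
  proof (rule ccontr)
    assume *: "\<not> ?thesis"
    let ?p = "monom 1 r - 1 :: 'a poly"
    have "coeff ?p r \<noteq> 0"
      using r by simp
    then have p: "?p \<noteq> 0"
      by (metis coeff_0)
    have "degree ?p \<le> r"
      by (intro degree_diff_le degree_monom_le) auto
    moreover have "card (k - {0}) \<le> card {x. poly ?p x = 0}"
      using * by (intro card_mono) (auto simp: poly_monom)
    ultimately show False
      using r card_poly_roots_bound[OF p] subfield_0 by simp
  qed
  then obtain y where y: "y \<in> k" "y \<noteq> 0" "y ^ r \<noteq> 1"
    by auto
  have "y ^ e = y ^ (e div (card k - 1) * (card k - 1) + r)"
    by (simp only: r_def div_mult_mod_eq)
  also have "\<dots> = y ^ r"
    using y by (subst power_add) (simp add: subfield_power_dvd)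
  finally show ?thesis
    using that y by simp
qed

text \<open>The shift by 1 permutes \<open>k\<close> but adds \<open>card k\<close> to the sum of
  all elements.\<close>

lemma of_nat_card_subfield: "of_nat (card k) = (0 :: 'a)"
proof -
  have "(\<lambda>x. x + 1) ` k = k"
    using subfield_add[OF _ subfield_1] by (intro endo_inj_surj) (auto simp: inj_on_def)
  then have "bij_betw (\<lambda>x. x + 1) k k"
    by (auto simp: bij_betw_def inj_on_def)
  then have "(\<Sum>x\<in>k. x) = (\<Sum>x\<in>k. x + 1)"
    using sum.reindex_bij_betw[of "\<lambda>x. x + 1" k k "\<lambda>x. x"] by simp
  then show ?thesis
    by (simp add: sum.distrib)
qed

text \<open>If some nonzero \<open>y\<close> has \<open>y ^ e \<noteq> 1\<close>, scaling by
  \<open>y\<close> permutes \<open>k\<close> and multiplies the sum by \<open>y ^ e\<close>, so the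
  sum is 0. If \<open>card k - 1\<close> divides \<open>e > 0\<close>, the sum counts the nonzero
  elements. For \<open>e = 0\<close> also \<open>0 ^ 0 = 1\<close> is counted, and
  \<open>card k\<close> is 0 in the field.\<close>

lemma sum_power_subfield:
  "(\<Sum>x\<in>k. x ^ e) = (if 0 < e \<and> card k - 1 dvd e then - 1 else 0)"
proof (cases "card k - 1 dvd e")
  case False
  then obtain y where y: "y \<in> k" "y \<noteq> 0" "y ^ e \<noteq> 1"
    using subfield_power_neq_1 by blast
  have "(\<Sum>x\<in>k. x ^ e) = (\<Sum>x\<in>k. (y * x) ^ e)"
    using sum.reindex_bij_betw[OF bij_betw_mult_subfield(1)[OF y(1,2)], of "\<lambda>x. x ^ e"] by simp
  also have "\<dots> = y ^ e * (\<Sum>x\<in>k. x ^ e)"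
    by (simp add: power_mult_distrib sum_distrib_left)
  finally show ?thesis
    using y(3) False by simp
next
  case True
  show ?thesis
  proof (cases "e = 0")
    case False
    have "(\<Sum>x\<in>k. x ^ e) = (\<Sum>x\<in>k - {0}. x ^ e)"
      using False by (intro sum.mono_neutral_right) (auto simp: zero_power)
    also have "\<dots> = (\<Sum>x\<in>k - {0}. 1)"
      using True by (intro sum.cong) (auto simp: subfield_power_dvd)
    also have "\<dots> = of_nat (card k) - 1"
      using subfield_0 card_subfield_ge_2 by (simp add: of_nat_diff)
    finally show ?thesis
      using True False by (simp add: of_nat_card_subfield)
  qed (simp add: of_nat_card_subfield)
qed

end

text \<open>Raising to the power \<open>card l - 1\<close> sends every nonzero element of
  \<open>k\<close> to 1, which is possible only for multiples of \<open>card k - 1\<close>.\<close>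

lemma subfield_card_dvd:
  fixes k l :: "'a::{field,finite} set"
  assumes "subfield k ring_of_type_algebra" "subfield l ring_of_type_algebra" "k \<subseteq> l"
  shows "card k - 1 dvd card l - 1"
  using subfield_power_neq_1[OF assms(1)] subfield_power_card[OF assms(2)] assms(3) by blast

section \<open>Lower bound for the degree of an indicator function\<close>

lemma m_exp_greater:
  assumes "d j \<ge> 2"
  shows "m_exp d j * (d j - 1) > (\<Sum>i=1..j-1. d i - 1)"
  unfolding m_exp_def
proof (rule LeastI)
  \<comment> \<open>Since \<open>d j - 1 \<ge> 1\<close>, the sum plus one is an admissible
    multiplier, so the least one exists.\<close>
  have "Suc (\<Sum>i=1..j-1. d i - 1) \<le> Suc (\<Sum>i=1..j-1. d i - 1) * (d j - 1)"
    using mult_le_mono2[of 1 "d j - 1" "Suc (\<Sum>i=1..j-1. d i - 1)"] assms by simp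
  then show "Suc (\<Sum>i=1..j-1. d i - 1) * (d j - 1) > (\<Sum>i=1..j-1. d i - 1)"
    by linarith
qed

lemma m_exp_le:
  assumes "m * (d j - 1) > (\<Sum>i=1..j-1. d i - 1)"
  shows "m_exp d j \<le> m"
  unfolding m_exp_def using assms by (rule Least_le)

text \<open>By minimality, one multiple of \<open>d j - 1\<close> less no longer exceeds the
  sum.\<close>

lemma m_exp_mult_le:
  assumes "d j \<ge> 2"
  shows "m_exp d j * (d j - 1) \<le> (\<Sum>i=1..j-1. d i - 1) + (d j - 1)"
proof (rule ccontr)
  let ?A = "\<Sum>i=1..j-1. d i - 1"
  assume "\<not> ?thesis"
  then have "(m_exp d j - 1) * (d j - 1) > ?A"
    by (simp add: diff_mult_distrib)
  then have "m_exp d j \<le> m_exp d j - 1"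
    by (rule m_exp_le)
  then show False
    using m_exp_greater[of d j, OF assms] by (cases "m_exp d j") auto
qed

lemma sum_indices_split:
  fixes f :: "nat \<Rightarrow> nat"
  assumes "1 \<le> j" "j \<le> n"
  shows "(\<Sum>i=1..n. f i) = (\<Sum>i=1..j-1. f i) + f j + (\<Sum>i=j+1..n. f i)"
proof -
  have "{1..n} = {1..j-1} \<union> {j} \<union> {j+1..n}"
    using assms by auto
  then have "(\<Sum>i=1..n. f i) = (\<Sum>i\<in>{1..j-1} \<union> {j} \<union> {j+1..n}. f i)"
    by simp
  also have "\<dots> = (\<Sum>i=1..j-1. f i) + f j + (\<Sum>i=j+1..n. f i)"
    using assms by (subst sum.union_disjoint; (subst sum.union_disjoint)?) auto
  finally show ?thesis .
qed

section \<open>Towers of subfields and sums over the affine grid\<close>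

locale subfield_tower =
  fixes F :: "nat \<Rightarrow> 'a::{field,finite} set" and n :: nat
  assumes subfield_F: "i \<le> n \<Longrightarrow> subfield (F i) (ring_of_type_algebra :: 'a ring)"
    and F_Suc: "i < n \<Longrightarrow> F i \<subseteq> F (Suc i)"
begin

abbreviation d :: "nat \<Rightarrow> nat" where "d i \<equiv> card (F i)"

lemma F_mono:
  assumes "i \<le> j" "j \<le> n"
  shows "F i \<subseteq> F j"
  using assms
proof (induction j rule: dec_induct)
  case (step j)
  then show ?case
    using F_Suc[of j] by auto
qed auto

lemma d_dvd: "i \<le> j \<Longrightarrow> j \<le> n \<Longrightarrow> d i - 1 dvd d j - 1"
  using subfield_card_dvd subfield_F F_mono by (meson le_trans)

lemma d_ge_2: "i \<le> n \<Longrightarrow> d i \<ge> 2"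
  using card_subfield_ge_2 subfield_F by blast

lemma zero_in_F: "i \<le> n \<Longrightarrow> 0 \<in> F i" and one_in_F: "i \<le> n \<Longrightarrow> 1 \<in> F i"
  using subfield_0 subfield_1 subfield_F by blast+

text \<open>Coordinate 0 is kept apart from the grid because the argument compares its two values 0
  and 1.\<close>

definition vec :: "'a \<Rightarrow> (nat \<Rightarrow> 'a) \<Rightarrow> nat \<Rightarrow> 'a" where
  "vec z x = (\<lambda>i. if i = 0 then z else if i \<le> n then x i else 0)"

text \<open>The weights \<open>x i ^ e i\<close> correct the degree modulo \<open>d j - 1\<close>;
  in the applications \<open>e\<close> is zero or supported at \<open>j\<close>.\<close>

definition grid_sum :: "(nat \<Rightarrow> nat) \<Rightarrow> 'a mpoly \<Rightarrow> 'a \<Rightarrow> 'a" where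
  "grid_sum e g z = (\<Sum>x\<in>Pi\<^sub>E {1..n} F. (\<Prod>i=1..n. x i ^ e i) * eval_mpoly g (vec z x))"

lemma mon_val_vec:
  assumes "Poly_Mapping.keys m \<subseteq> {0..n}"
  shows "mon_val (vec z x) m =
    z ^ Poly_Mapping.lookup m 0 * (\<Prod>i=1..n. x i ^ Poly_Mapping.lookup m i)"
proof -
  have "mon_val (vec z x) m = (\<Prod>i=0..n. vec z x i ^ Poly_Mapping.lookup m i)"
    using assms by (intro mon_val_superset) auto
  also have "\<dots> = vec z x 0 ^ Poly_Mapping.lookup m 0 *
      (\<Prod>i=1..n. vec z x i ^ Poly_Mapping.lookup m i)"
    by (simp add: prod.atLeast_Suc_atMost)
  also have "(\<Prod>i=1..n. vec z x i ^ Poly_Mapping.lookup m i) =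
      (\<Prod>i=1..n. x i ^ Poly_Mapping.lookup m i)"
    by (intro prod.cong) (auto simp: vec_def)
  finally show ?thesis
    by (simp add: vec_def)
qed

text \<open>On the grid each term of \<open>g\<close> is a product of functions of one coordinate,
  so its sum factors into power sums.\<close>

lemma grid_sum_expand:
  assumes "g \<in> polys n"
  shows "grid_sum e g z = (\<Sum>m\<in>Poly_Mapping.keys g. Poly_Mapping.lookup g m *
    (z ^ Poly_Mapping.lookup m 0 *
      (\<Prod>i=1..n. \<Sum>y\<in>F i. y ^ (e i + Poly_Mapping.lookup m i))))"
proof -
  have "grid_sum e g z = (\<Sum>x\<in>Pi\<^sub>E {1..n} F. \<Sum>m\<in>Poly_Mapping.keys g.
      Poly_Mapping.lookup g m * (z ^ Poly_Mapping.lookup m 0 *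
        (\<Prod>i=1..n. x i ^ (e i + Poly_Mapping.lookup m i))))"
    unfolding grid_sum_def eval_mpoly_altdef sum_distrib_left
  proof (intro sum.cong refl)
    fix x m assume "m \<in> Poly_Mapping.keys g"
    then have "Poly_Mapping.keys m \<subseteq> {0..n}"
      using assms by (auto simp: polys_def)
    then show "(\<Prod>i=1..n. x i ^ e i) * (Poly_Mapping.lookup g m * mon_val (vec z x) m) =
        Poly_Mapping.lookup g m * (z ^ Poly_Mapping.lookup m 0 *
        (\<Prod>i=1..n. x i ^ (e i + Poly_Mapping.lookup m i)))"
      by (simp add: mon_val_vec power_add prod.distrib ac_simps)
  qed
  also have "\<dots> = (\<Sum>m\<in>Poly_Mapping.keys g. Poly_Mapping.lookup g m *
    (z ^ Poly_Mapping.lookup m 0 *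
      (\<Sum>x\<in>Pi\<^sub>E {1..n} F. \<Prod>i=1..n. x i ^ (e i + Poly_Mapping.lookup m i))))"
    unfolding sum_distrib_left by (rule sum.swap)
  finally show ?thesis
    by (simp add: prod_sum_PiE)
qed

text \<open>A monomial survives the summation over the grid only if its weighted exponent of every
  \<open>t\<^sub>i\<close> with \<open>i \<ge> 1\<close> is at least \<open>d\<^sub>i - 1\<close>; in low degree this leaves no room for \<open>t\<^sub>0\<close>.\<close>

lemma grid_sum_low_degree:
  assumes g: "g \<in> graded_part n D" and D: "D + (\<Sum>i=1..n. e i) \<le> (\<Sum>i=1..n. d i - 1)"
  shows "grid_sum e g 1 = grid_sum e g 0"
proof -
  have gp: "g \<in> polys n"
    using g graded_part_subset_polys by blast
  show ?thesis
    unfolding grid_sum_expand[OF gp]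
  proof (intro sum.cong refl)
    fix m assume m: "m \<in> Poly_Mapping.keys g"
    let ?l = "Poly_Mapping.lookup m"
    have "Poly_Mapping.keys m \<subseteq> {0..n}"
      using m gp by (auto simp: polys_def)
    then have "D = (\<Sum>i=0..n. ?l i)"
      using m g mon_deg_superset[of "{0..n}" m] by (auto simp: graded_part_def)
    then have D_eq: "D = ?l 0 + (\<Sum>i=1..n. ?l i)"
      by (simp add: sum.atLeast_Suc_atMost)
    have "?l 0 = 0" if nz: "(\<Prod>i=1..n. \<Sum>y\<in>F i. y ^ (e i + ?l i)) \<noteq> 0"
    proof -
      have "d i - 1 \<le> e i + ?l i" if i: "i \<in> {1..n}" for i
      proof -
        have "(\<Sum>y\<in>F i. y ^ (e i + ?l i)) \<noteq> 0"
          using nz i by auto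
        then show ?thesis
          using sum_power_subfield[OF subfield_F, of i "e i + ?l i"] i
          by (auto split: if_splits intro: dvd_imp_le)
      qed
      then have "(\<Sum>i=1..n. d i - 1) \<le> (\<Sum>i=1..n. e i + ?l i)"
        by (rule sum_mono)
      then show ?thesis
        using D D_eq by (simp add: sum.distrib)
    qed
    \<comment> \<open>Terms with a nonzero product are free of \<open>t_0\<close>, and
      \<open>0 ^ 0 = 1\<close>, so both values of the coordinate 0 give the same
      contribution.\<close>
    then show "Poly_Mapping.lookup g m * (1 ^ ?l 0 * (\<Prod>i=1..n. \<Sum>y\<in>F i. y ^ (e i + ?l i))) =
        Poly_Mapping.lookup g m * (0 ^ ?l 0 * (\<Prod>i=1..n. \<Sum>y\<in>F i. y ^ (e i + ?l i)))"
      by (cases "(\<Prod>i=1..n. \<Sum>y\<in>F i. y ^ (e i + ?l i)) = 0") auto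
  qed
qed

definition tower_vecs :: "(nat \<Rightarrow> 'a) set" where
  "tower_vecs = {a \<in> nonzero_vecs n. \<forall>i\<le>n. a i \<in> F i}"

section \<open>Degree bounds for forms that are nonzero only at a unit point\<close>

context
  fixes g D j
  assumes g: "g \<in> graded_part n D" and D_pos: "0 < D" and j: "j \<le> n"
    and nonzero: "eval_mpoly g (unit_vec j) \<noteq> 0"
    and zero: "\<And>a i. a \<in> tower_vecs \<Longrightarrow> i \<le> n \<Longrightarrow> i \<noteq> j \<Longrightarrow> a i \<noteq> 0 \<Longrightarrow> eval_mpoly g a = 0"
begin

lemma eval_vec_eq_0:
  assumes "z = 0 \<or> z = 1" "x \<in> Pi\<^sub>E {1..n} F" "i \<le> n" "i \<noteq> j" "vec z x i \<noteq> 0"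
  shows "eval_mpoly g (vec z x) = 0"
proof (rule zero)
  have "vec z x k \<in> F k" if "k \<le> n" for k
    using assms that zero_in_F one_in_F by (auto simp: vec_def PiE_def Pi_def)
  moreover have "vec z x k = 0" if "k > n" for k
    using that by (simp add: vec_def)
  ultimately show "vec z x \<in> tower_vecs"
    using assms by (auto simp: tower_vecs_def nonzero_vecs_def)
qed (use assms in auto)

lemma eval_scaled_unit: "eval_mpoly g (\<lambda>i. c * unit_vec j i) = c ^ D * eval_mpoly g (unit_vec j)"
  by (rule eval_mpoly_scale[OF g])

text \<open>Only the origin of the grid contributes. For \<open>z = 1\<close> it gives
  \<open>[e_0]\<close>, where \<open>g\<close> is nonzero; for \<open>z = 0\<close> it gives the
  zero vector, where \<open>g\<close> vanishes because \<open>D > 0\<close>. So the two sums differ,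
  and the degree cannot be low.\<close>

lemma degree_ge_0:
  assumes "j = 0"
  shows "1 + (\<Sum>i=1..n. d i - 1) \<le> D"
proof (rule ccontr)
  assume "\<not> ?thesis"
  then have eq: "grid_sum (\<lambda>_. 0) g 1 = grid_sum (\<lambda>_. 0) g 0"
    by (intro grid_sum_low_degree[OF g]) auto
  let ?o = "\<lambda>i\<in>{1..n}. 0"
  have o: "?o \<in> Pi\<^sub>E {1..n} F"
    using zero_in_F by auto
  have *: "grid_sum (\<lambda>_. 0) g z = eval_mpoly g (vec z ?o)" if z: "z = 0 \<or> z = 1" for z
  proof -
    have "eval_mpoly g (vec z x) = 0" if x: "x \<in> Pi\<^sub>E {1..n} F - {?o}" for x
    proof -
      have "\<exists>i\<in>{1..n}. x i \<noteq> 0"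
        using x o by (metis (no_types, lifting) Diff_iff PiE_ext restrict_apply singletonI)
      then obtain i where "i \<in> {1..n}" "x i \<noteq> 0"
        by blast
      then show ?thesis
        using eval_vec_eq_0[OF z, of x i] x assms by (auto simp: vec_def)
    qed
    then have "grid_sum (\<lambda>_. 0) g z = (\<Sum>x\<in>{?o}. eval_mpoly g (vec z x))"
      unfolding grid_sum_def using o by (intro sum.mono_neutral_cong_right finite_PiE) auto
    then show ?thesis
      by simp
  qed
  have "vec z ?o = (\<lambda>i. z * unit_vec j i)" for z
    using assms by (auto simp: vec_def unit_vec_def)
  then have "grid_sum (\<lambda>_. 0) g 1 \<noteq> 0" "grid_sum (\<lambda>_. 0) g 0 = 0"
    using *[of 1] *[of 0] nonzero D_pos eval_scaled_unit[of 0] by (simp_all add: zero_power)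
  then show False
    using eq by simp
qed

text \<open>For \<open>z = 1\<close> every vector has a nonzero coordinate 0, so the sum is 0. For
  \<open>z = 0\<close> only the multiples \<open>y e_j\<close> contribute, and the power sum of the
  \<open>y ^ (D + e)\<close> is -1 by divisibility.\<close>

lemma degree_plus_ge:
  assumes "j \<ge> 1" "d j - 1 dvd D + e"
  shows "1 + (\<Sum>i=1..n. d i - 1) \<le> D + e"
proof (rule ccontr)
  assume less: "\<not> ?thesis"
  let ?e = "\<lambda>i. if i = j then e else 0"
  have "(\<Sum>i=1..n. ?e i) = e"
    using j assms(1) by simp
  then have eq: "grid_sum ?e g 1 = grid_sum ?e g 0"
    using less by (intro grid_sum_low_degree[OF g]) auto
  have "eval_mpoly g (vec 1 x) = 0" if "x \<in> Pi\<^sub>E {1..n} F" for x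
    using that assms eval_vec_eq_0[of 1 x 0] by (simp add: vec_def)
  then have "grid_sum ?e g 1 = 0"
    unfolding grid_sum_def by (intro sum.neutral) auto
  have prod_e: "(\<Prod>i=1..n. x i ^ ?e i) = x j ^ e" for x :: "nat \<Rightarrow> 'a"
  proof -
    have "(\<Prod>i=1..n. x i ^ ?e i) = (\<Prod>i=1..n. if i = j then x j ^ e else 1)"
      by (intro prod.cong) auto
    then show ?thesis
      using j assms(1) by simp
  qed
  \<comment> \<open>The grid point of \<open>y e_j\<close>. The value \<open>y = 0\<close> is
    included to obtain a sum over the whole field; it contributes 0 since
    \<open>D > 0\<close>.\<close>
  let ?h = "\<lambda>y. \<lambda>i\<in>{1..n}. if i = j then y else 0"
  have "eval_mpoly g (vec 0 x) = 0" if x: "x \<in> Pi\<^sub>E {1..n} F - ?h ` F j" for x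
  proof -
    have "\<exists>i\<in>{1..n}. i \<noteq> j \<and> x i \<noteq> 0"
    proof (rule ccontr)
      assume "\<not> ?thesis"
      then have "x = ?h (x j)"
        using x by (auto simp: fun_eq_iff PiE_def extensional_def)
      moreover have "x j \<in> F j"
        using x j assms(1) by (auto simp: PiE_def Pi_def)
      ultimately show False
        using x by blast
    qed
    then obtain i where "i \<in> {1..n}" "i \<noteq> j" "x i \<noteq> 0"
      by blast
    then show ?thesis
      using eval_vec_eq_0[of 0 x i] x by (auto simp: vec_def)
  qed
  moreover have "?h ` F j \<subseteq> Pi\<^sub>E {1..n} F"
    using zero_in_F by auto
  ultimately have "grid_sum ?e g 0 = (\<Sum>x\<in>?h ` F j. x j ^ e * eval_mpoly g (vec 0 x))"
    unfolding grid_sum_def prod_e by (intro sum.mono_neutral_right finite_PiE) auto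
  also have "\<dots> = (\<Sum>y\<in>F j. ?h y j ^ e * eval_mpoly g (vec 0 (?h y)))"
  proof (subst sum.reindex)
    show "inj_on ?h (F j)"
    proof (rule inj_onI)
      fix x y assume "?h x = ?h y"
      then have "?h x j = ?h y j"
        by (rule fun_cong)
      then show "x = y"
        using j assms(1) by simp
    qed
  qed simp
  also have "\<dots> = (\<Sum>y\<in>F j. y ^ (D + e) * eval_mpoly g (unit_vec j))"
  proof (intro sum.cong refl)
    fix y
    have "vec 0 (?h y) = (\<lambda>i. y * unit_vec j i)"
      using assms(1) j by (auto simp: vec_def unit_vec_def)
    then show "?h y j ^ e * eval_mpoly g (vec 0 (?h y)) = y ^ (D + e) * eval_mpoly g (unit_vec j)"
      using assms(1) j by (simp add: eval_scaled_unit power_add)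
  qed
  also have "\<dots> = (\<Sum>y\<in>F j. y ^ (D + e)) * eval_mpoly g (unit_vec j)"
    by (simp add: sum_distrib_right)
  also have "\<dots> = - eval_mpoly g (unit_vec j)"
    using sum_power_subfield[OF subfield_F[OF j], of "D + e"] assms(2) D_pos by simp
  finally show False
    using eq \<open>grid_sum ?e g 1 = 0\<close> nonzero by simp
qed

lemma degree_ge:
  assumes "j \<ge> 1"
  shows "m_exp d j * (d j - 1) + 1 + (\<Sum>i=j+1..n. d i - 1) \<le> D"
proof -
  define c A B where "c = d j - 1" and "A = (\<Sum>i=1..j-1. d i - 1)" and "B = (\<Sum>i=j+1..n. d i - 1)"
  have c: "c \<ge> 1"
    using d_ge_2[OF j] by (simp add: c_def)
  \<comment> \<open>The fields increase, so \<open>d j - 1\<close> divides each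
    \<open>d i - 1\<close> with \<open>i > j\<close>.\<close>
  have "c dvd B"
    unfolding B_def c_def by (intro dvd_sum d_dvd) auto
  then obtain b where b: "B = c * b"
    by blast
  \<comment> \<open>The least \<open>e\<close> for which \<open>c\<close> divides
    \<open>D + e\<close>; the outer \<open>mod\<close> gives 0 when \<open>c\<close> already divides
    \<open>D\<close>.\<close>
  define e where "e = (c - D mod c) mod c"
  have e: "e < c"
    using c by (simp add: e_def)
  have "(D + e) mod c = (D mod c + (c - D mod c)) mod c"
    by (simp add: e_def mod_simps)
  also have "\<dots> = 0"
    using c by (simp add: less_imp_le)
  finally have "c dvd D + e"
    by (simp add: mod_eq_0_iff_dvd)
  then obtain t where t: "D + e = c * t"
    by blast
  have "(\<Sum>i=1..n. d i - 1) = A + c + B"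
    unfolding A_def B_def c_def using assms j by (rule sum_indices_split)
  then have "1 + (A + c + c * b) \<le> c * t"
    using degree_plus_ge[OF assms, folded c_def, OF \<open>c dvd D + e\<close>] unfolding t b by simp
  \<comment> \<open>Dividing out \<open>c\<close> turns the bound into the defining inequality of
    \<open>m_exp d j\<close>. In the end \<open>e \<le> c - 1\<close> leaves exactly the summand
    1.\<close>
  then have *: "A < (t - b - 1) * c"
    by (simp add: diff_mult_distrib mult.commute[of c])
  then have "m_exp d j \<le> t - b - 1"
    unfolding A_def c_def by (rule m_exp_le)
  then have "m_exp d j * c \<le> (t - b - 1) * c"
    by simp
  then have "m_exp d j * c + c + B \<le> D + e"
    using * t b by (simp add: diff_mult_distrib mult.commute[of c])
  then show ?thesis
    using e unfolding c_def[symmetric] B_def[symmetric] by simp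
qed

end

end

section \<open>The explicit indicator functions\<close>

text \<open>Inclusion-exclusion, grouped by the size of the subset to match the double sum in
  \<open>ind_f1\<close>.\<close>

lemma prod_one_minus_by_card:
  fixes y :: "nat \<Rightarrow> 'a::comm_ring_1"
  assumes "finite B"
  shows "(\<Prod>i\<in>B. 1 - y i) =
    (\<Sum>s=0..card B. \<Sum>A | A \<subseteq> B \<and> card A = s. (- 1) ^ s * (\<Prod>i\<in>A. y i))"
proof -
  have "(\<Prod>i\<in>B. 1 - y i) = (\<Sum>A\<in>Pow B. (- 1) ^ card A * (\<Prod>i\<in>A. y i))"
    using assms by (subst prod_diff_conv_sum) auto
  also have "\<dots> = (\<Sum>s\<in>{0..card B}. \<Sum>A\<in>{A \<in> Pow B. card A = s}. (- 1) ^ card A * (\<Prod>i\<in>A. y i))"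
    using assms by (intro sum.group[symmetric]) (auto simp: card_mono)
  also have "\<dots> = (\<Sum>s=0..card B. \<Sum>A | A \<subseteq> B \<and> card A = s. (- 1) ^ s * (\<Prod>i\<in>A. y i))"
    by (intro sum.cong) auto
  finally show ?thesis .
qed

section \<open>Degrees of the explicit polynomials\<close>

context subfield_tower
begin

text \<open>All \<open>j \<ge> 1\<close> share one formula: for \<open>j = 1\<close> it gives the
  value expected for the regularity, and for \<open>j = n\<close> the last sum is empty.\<close>

definition ind_deg :: "nat \<Rightarrow> nat" where
  "ind_deg j = (if j = 0 then 1 + (\<Sum>i=1..n. d i - 1)
    else m_exp d j * (d j - 1) + 1 + (\<Sum>i=j+1..n. d i - 1))"

lemma m_exp_1:
  assumes "1 \<le> n"
  shows "m_exp d 1 = 1"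
proof -
  have "m_exp d 1 * (d 1 - 1) = 1 * (d 1 - 1)"
    using m_exp_greater[of d 1] m_exp_mult_le[of d 1] d_ge_2[OF assms]
    by (cases "m_exp d 1") auto
  then show ?thesis
    using d_ge_2[OF assms] by (simp only: mult_cancel2) simp
qed

lemma ind_deg_1: "1 \<le> n \<Longrightarrow> ind_deg 1 = 1 + (\<Sum>i=1..n. d i - 1)"
  using m_exp_1 by (simp add: ind_deg_def sum.atLeast_Suc_atMost)

text \<open>Rounding the sum over \<open>i < j\<close> up to a multiple of \<open>d j - 1\<close>
  costs at most \<open>d j - 1\<close>. This lets every \<open>[e_j]\<close> have an indicator
  function in the degree of the regularity.\<close>

lemma ind_deg_le:
  assumes "j \<le> n"
  shows "ind_deg j \<le> 1 + (\<Sum>i=1..n. d i - 1)"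
proof (cases "j = 0")
  case False
  then show ?thesis
    using sum_indices_split[of j n "\<lambda>i. d i - 1"] assms m_exp_mult_le[of d j, OF d_ge_2[OF assms]]
    by (simp add: ind_deg_def)
qed (simp add: ind_deg_def)

text \<open>Ensures that the differences in the exponents of \<open>ind_f1\<close> and
  \<open>ind_f2\<close> are positive, so that subtraction on naturals does not truncate.\<close>

lemma sum_subset_less_m_exp:
  assumes "1 \<le> j" "j \<le> n" "A \<subseteq> {1..j-1}"
  shows "(\<Sum>i\<in>A. d i - 1) < m_exp d j * (d j - 1)"
proof -
  have "(\<Sum>i\<in>A. d i - 1) \<le> (\<Sum>i=1..j-1. d i - 1)"
    using assms by (intro sum_mono2) auto
  then show ?thesis
    using m_exp_greater[of d j, OF d_ge_2[OF assms(2)]] by linarith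
qed

lemma graded_ind_f1:
  assumes "2 \<le> j" "j \<le> n"
  shows "(ind_f1 d j :: 'a mpoly) \<in> graded_part n (m_exp d j * (d j - 1))"
proof -
  let ?M = "m_exp d j * (d j - 1)"
  have "(-1) ^ s * Var (Min A) ^ (?M - (\<Sum>i\<in>A - {Min A}. d i - 1)) *
      (\<Prod>i\<in>A - {Min A}. Var i ^ (d i - 1)) \<in> (graded_part n ?M :: 'a mpoly set)"
    if A: "A \<subseteq> {1..j-1}" "card A = s" "s \<in> {2..j-1}" for A s
  proof (rule graded_part_mult')
    have le_n: "i \<le> n" if "i \<in> A" for i
      using subsetD[OF A(1) that] assms by auto
    have "A \<noteq> {}" "finite A"
      using A finite_subset[of A "{1..j-1}"] by auto
    then have "Min A \<in> A"
      by (rule Min_in[rotated])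
    have "(- 1 :: 'a mpoly) ^ s \<in> graded_part n (s * 0)"
      by (intro graded_part_power graded_part_uminus graded_part_one)
    then show "(-1) ^ s * Var (Min A) ^ (?M - (\<Sum>i\<in>A - {Min A}. d i - 1)) \<in>
        (graded_part n (?M - (\<Sum>i\<in>A - {Min A}. d i - 1)) :: 'a mpoly set)"
      using le_n[OF \<open>Min A \<in> A\<close>] by (intro graded_part_mult'[OF _ graded_part_Var_power]) auto
    show "(\<Prod>i\<in>A - {Min A}. Var i ^ (d i - 1)) \<in>
        (graded_part n (\<Sum>i\<in>A - {Min A}. d i - 1) :: 'a mpoly set)"
      using \<open>finite A\<close> le_n by (intro graded_part_prod graded_part_Var_power) auto
    have "(\<Sum>i\<in>A - {Min A}. d i - 1) < ?M"
      using A assms by (intro sum_subset_less_m_exp) auto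
    then show "?M - (\<Sum>i\<in>A - {Min A}. d i - 1) + (\<Sum>i\<in>A - {Min A}. d i - 1) = ?M"
      by simp
  qed
  then show ?thesis
    unfolding ind_f1_def Let_def using assms
    by (intro graded_part_add graded_part_diff graded_part_sum graded_part_Var_power) auto
qed

lemma graded_ind_f2:
  assumes "2 \<le> j" "j \<le> n"
  shows "(ind_f2 d j :: 'a mpoly) \<in> graded_part n (m_exp d j * (d j - 1))"
  unfolding ind_f2_def
proof (rule graded_part_mult')
  show "(\<Prod>i=1..j-1. Var 0 ^ (d i - 1) - Var i ^ (d i - 1)) \<in>
      (graded_part n (\<Sum>i=1..j-1. d i - 1) :: 'a mpoly set)"
    using assms by (intro graded_part_prod graded_part_diff graded_part_Var_power) auto
  show "m_exp d j * (d j - 1) - (\<Sum>i=1..j-1. d i - 1) + (\<Sum>i=1..j-1. d i - 1) =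
      m_exp d j * (d j - 1)"
    using sum_subset_less_m_exp[of j "{1..j-1}"] assms by simp
qed (intro graded_part_Var_power, simp)

lemma graded_ind_poly:
  assumes "1 \<le> n" "j \<le> n"
  shows "(ind_poly n d j :: 'a mpoly) \<in> graded_part n (ind_deg j)"
proof -
  have tail: "(\<Prod>l=k..n. Var l ^ (d l - 1) - Var j ^ (d l - 1)) \<in>
      (graded_part n (\<Sum>l=k..n. d l - 1) :: 'a mpoly set)" for k
    using assms by (intro graded_part_prod graded_part_diff graded_part_Var_power) auto
  consider "j = 0" | "j = 1" | "2 \<le> j"
    by linarith
  then show ?thesis
  proof cases
    case 1
    then show ?thesis
      using tail[of 1] assms graded_part_mult[OF graded_part_Var[OF assms(2)] tail[of 1]]
      by (simp add: ind_poly_def ind_deg_def)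
  next
    case 2
    have "(Var 1 * (Var 1 ^ (d 1 - 1) - Var 0 ^ (d 1 - 1)) :: 'a mpoly) \<in> graded_part n (1 + (d 1 - 1))"
      using assms by (intro graded_part_mult graded_part_diff graded_part_Var graded_part_Var_power) auto
    then have "(Var 1 * (Var 1 ^ (d 1 - 1) - Var 0 ^ (d 1 - 1)) *
        (\<Prod>l=2..n. Var l ^ (d l - 1) - Var j ^ (d l - 1)) :: 'a mpoly) \<in> graded_part n (ind_deg 1)"
      by (rule graded_part_mult'[OF _ tail]) (use m_exp_1[OF assms(1)] in \<open>simp add: ind_deg_def numeral_2_eq_2\<close>)
    then show ?thesis
      using 2 by (simp add: ind_poly_def)
  next
    case 3
    have "(Var j * (ind_f1 d j - ind_f2 d j) :: 'a mpoly) \<in> graded_part n (1 + m_exp d j * (d j - 1))"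
      using 3 assms
      by (intro graded_part_mult graded_part_diff graded_part_Var graded_ind_f1 graded_ind_f2) auto
    then have "(Var j * (ind_f1 d j - ind_f2 d j) *
        (\<Prod>l=j+1..n. Var l ^ (d l - 1) - Var j ^ (d l - 1)) :: 'a mpoly) \<in> graded_part n (ind_deg j)"
      by (rule graded_part_mult'[OF _ tail]) (use 3 in \<open>simp add: ind_deg_def\<close>)
    then show ?thesis
      using 3 by (simp add: ind_poly_def)
  qed
qed

section \<open>Values of the explicit polynomials at the points\<close>

definition supp :: "(nat \<Rightarrow> 'a) \<Rightarrow> nat \<Rightarrow> 'a" where
  "supp a i = (if a i = 0 then 0 else 1)"

context
  fixes a :: "nat \<Rightarrow> 'a"
  assumes a: "\<And>i. i \<le> n \<Longrightarrow> a i \<in> F i"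
begin

lemma power_eq_supp:
  assumes "i \<le> j" "j \<le> n" "0 < e" "d i - 1 dvd e"
  shows "a i ^ e = supp a i"
  using assms a subfield_power_dvd[OF subfield_F, of i "a i" e] by (auto simp: supp_def zero_power)

lemma power_eq_supp':
  assumes "i \<le> j" "j \<le> n"
  shows "a i ^ (d j - 1) = supp a i"
  using assms d_ge_2[of j] by (intro power_eq_supp[of i j] d_dvd) auto

text \<open>As the fields increase, \<open>d i - 1\<close> divides \<open>d k - 1\<close> for all
  \<open>k \<ge> i\<close>, hence the whole exponent. This is why the smallest index of a subset
  carries the remaining exponent in \<open>ind_f1\<close>, and \<open>t_0\<close> carries it in
  \<open>ind_f2\<close>.\<close>

lemma power_m_exp_diff:
  assumes "1 \<le> j" "j \<le> n" "A \<subseteq> {1..j-1}" "i \<le> j" "\<And>k. k \<in> A \<Longrightarrow> i \<le> k"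
  shows "a i ^ (m_exp d j * (d j - 1) - (\<Sum>k\<in>A. d k - 1)) = supp a i"
proof (rule power_eq_supp[OF assms(4,2)])
  show "0 < m_exp d j * (d j - 1) - (\<Sum>k\<in>A. d k - 1)"
    using sum_subset_less_m_exp[OF assms(1-3)] by simp
  have "d i - 1 dvd d j - 1"
    using assms by (intro d_dvd) auto
  moreover have "d i - 1 dvd d k - 1" if "k \<in> A" for k
    using that assms subsetD[OF assms(3) that] by (intro d_dvd) auto
  ultimately show "d i - 1 dvd m_exp d j * (d j - 1) - (\<Sum>k\<in>A. d k - 1)"
    by (intro dvd_diff_nat[OF _ dvd_sum] dvd_mult) auto
qed

text \<open>The sum over \<open>i\<close> and the sum over \<open>s \<ge> 2\<close> are the parts
  \<open>s = 1\<close> and \<open>s \<ge> 2\<close> of the expanded product; the absent part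
  \<open>s = 0\<close> accounts for the -1.\<close>

lemma eval_ind_f1:
  assumes "2 \<le> j" "j \<le> n"
  shows "eval_mpoly (ind_f1 d j) a = supp a j - 1 + (\<Prod>i=1..j-1. 1 - supp a i)"
proof -
  let ?M = "m_exp d j * (d j - 1)"
  let ?T = "\<lambda>s. \<Sum>A | A \<subseteq> {1..j-1} \<and> card A = s. (- 1) ^ s * (\<Prod>i\<in>A. supp a i)"
  have M: "a i ^ ?M = supp a i" if "i \<le> j" for i
    using power_m_exp_diff[of j "{}" i] that assms by simp
  have summand: "a (Min A) ^ (?M - (\<Sum>i\<in>A - {Min A}. d i - 1)) *
      (\<Prod>i\<in>A - {Min A}. a i ^ (d i - 1)) = (\<Prod>i\<in>A. supp a i)"
    if A: "A \<subseteq> {1..j-1}" "A \<noteq> {}" for A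
  proof -
    have fin: "finite A"
      using A finite_subset by blast
    then have Min: "Min A \<in> A"
      using A by simp
    have "a (Min A) ^ (?M - (\<Sum>i\<in>A - {Min A}. d i - 1)) = supp a (Min A)"
    proof (rule power_m_exp_diff)
      show "Min A \<le> j"
        using subsetD[OF A(1) Min] by auto
    qed (use A fin assms in auto)
    moreover have "(\<Prod>i\<in>A - {Min A}. a i ^ (d i - 1)) = (\<Prod>i\<in>A - {Min A}. supp a i)"
      using A assms by (intro prod.cong power_eq_supp') auto
    ultimately show ?thesis
      using prod.remove[OF fin Min, of "supp a"] by simp
  qed
  have "eval_mpoly (ind_f1 d j) a = supp a j - (\<Sum>i=1..j-1. supp a i) + (\<Sum>s=2..j-1. ?T s)"
  proof -
    have "(\<Sum>i=1..j-1. a i ^ ?M) = (\<Sum>i=1..j-1. supp a i)"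
      using M by (intro sum.cong) auto
    moreover have "(\<Sum>A | A \<subseteq> {1..j-1} \<and> card A = s.
        (-1) ^ s * a (Min A) ^ (?M - (\<Sum>i\<in>A - {Min A}. d i - 1)) *
          (\<Prod>i\<in>A - {Min A}. a i ^ (d i - 1))) = ?T s" if "s \<in> {2..j-1}" for s
    proof (intro sum.cong refl)
      fix A assume "A \<in> {A. A \<subseteq> {1..j-1} \<and> card A = s}"
      with that have A: "A \<subseteq> {1..j-1}" "A \<noteq> {}"
        by auto
      show "(-1) ^ s * a (Min A) ^ (?M - (\<Sum>i\<in>A - {Min A}. d i - 1)) *
          (\<Prod>i\<in>A - {Min A}. a i ^ (d i - 1)) = (- 1) ^ s * (\<Prod>i\<in>A. supp a i)"
        unfolding mult.assoc summand[OF A] ..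
    qed
    ultimately show ?thesis
      using M[of j] by (simp add: ind_f1_def Let_def)
  qed
  moreover have "(\<Prod>i=1..j-1. 1 - supp a i) = ?T 0 + (?T 1 + (\<Sum>s=2..j-1. ?T s))"
    using assms by (subst prod_one_minus_by_card) (auto simp: sum.atLeast_Suc_atMost numeral_2_eq_2)
  moreover have "?T 0 = 1"
  proof -
    have "{A. A \<subseteq> {1..j-1} \<and> card A = 0} = {{}}"
      using finite_subset[of _ "{1..j-1}"] by auto
    then show ?thesis
      by simp
  qed
  moreover have "?T 1 = - (\<Sum>i=1..j-1. supp a i)"
  proof -
    have "{A. A \<subseteq> {1..j-1} \<and> card A = 1} = (\<lambda>i. {i}) ` {1..j-1}"
      by (auto simp: card_1_singleton_iff)
    then show ?thesis
      by (simp add: sum.reindex sum_negf)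
  qed
  ultimately show ?thesis
    by simp
qed

lemma eval_ind_f2:
  assumes "2 \<le> j" "j \<le> n"
  shows "eval_mpoly (ind_f2 d j) a = supp a 0 * (\<Prod>i=1..j-1. 1 - supp a i)"
proof -
  have "a 0 ^ (m_exp d j * (d j - 1) - (\<Sum>i=1..j-1. d i - 1)) = supp a 0"
    using assms by (intro power_m_exp_diff) auto
  moreover have "(\<Prod>i=1..j-1. a 0 ^ (d i - 1) - a i ^ (d i - 1)) = (\<Prod>i=1..j-1. supp a 0 - supp a i)"
    using assms power_eq_supp' by (intro prod.cong refl arg_cong2[where f = "(-)"]) auto
  ultimately show ?thesis
    \<comment> \<open>If \<open>a 0 = 0\<close>, both sides vanish; otherwise
      \<open>supp a 0 = 1\<close>.\<close>
    by (simp add: ind_f2_def) (simp add: supp_def)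
qed

lemma eval_tail:
  assumes "j < k"
  shows "(\<Prod>l=k..n. a l ^ (d l - 1) - a j ^ (d l - 1)) = (\<Prod>l=k..n. supp a l - supp a j)"
  using assms power_eq_supp' by (intro prod.cong refl arg_cong2[where f = "(-)"]) auto

text \<open>A common form for the three cases. When \<open>a j \<noteq> 0\<close>, the middle factor
  is nonzero only if all coordinates before \<open>j\<close> vanish, and the last product only if
  all coordinates after \<open>j\<close> vanish.\<close>

lemma eval_ind_poly:
  assumes "j \<le> n"
  shows "eval_mpoly (ind_poly n d j) a = a j *
    (supp a j - 1 + (if j = 0 then 1 else (1 - supp a 0) * (\<Prod>i=1..j-1. 1 - supp a i))) *
    (\<Prod>l=j+1..n. supp a l - supp a j)"
proof -
  consider "j = 0" | "j = 1" | "2 \<le> j"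
    by linarith
  then show ?thesis
  proof cases
    case 1
    then show ?thesis
      using eval_tail[of 0 1] by (simp add: ind_poly_def) (simp add: supp_def)
  next
    case 2
    then have "a 1 ^ (d 1 - 1) = supp a 1" "a 0 ^ (d 1 - 1) = supp a 0"
      using power_eq_supp' assms by auto
    then show ?thesis
      using 2 eval_tail[of 1 2] by (simp add: ind_poly_def numeral_2_eq_2)
  next
    case 3
    then have "eval_mpoly (ind_f1 d j) a - eval_mpoly (ind_f2 d j) a =
        supp a j - 1 + (1 - supp a 0) * (\<Prod>i=1..j-1. 1 - supp a i)"
      by (simp add: eval_ind_f1 eval_ind_f2 assms left_diff_distrib)
    then show ?thesis
      using 3 eval_tail[of j "j + 1"] by (simp add: ind_poly_def)
  qed
qed

lemma eval_ind_poly_eq_0: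
  assumes "j \<le> n" "i \<le> n" "i \<noteq> j" "a i \<noteq> 0"
  shows "eval_mpoly (ind_poly n d j) a = 0"
proof (cases "a j = 0")
  case False
  consider "j < i" | "i = 0" "0 < j" | "1 \<le> i" "i < j"
    using assms(3) by linarith
  then show ?thesis
    using False assms unfolding eval_ind_poly[OF assms(1)]
    by cases (auto simp: supp_def prod_zero_iff)
qed (simp add: eval_ind_poly assms)

end

lemma eval_ind_poly_unit_vec:
  assumes "j \<le> n"
  shows "eval_mpoly (ind_poly n d j) (unit_vec j) \<noteq> (0 :: 'a)"
proof -
  have u: "unit_vec j i \<in> F i" if "i \<le> n" for i
    using that zero_in_F one_in_F by (simp add: unit_vec_def)
  have "(\<Prod>i=1..j-1. 1 - supp (unit_vec j) i) = 1"
    by (intro prod.neutral) (auto simp: supp_def unit_vec_def)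
  moreover have "(\<Prod>l=j+1..n. supp (unit_vec j) l - supp (unit_vec j) j) \<noteq> 0"
    by (auto simp: prod_zero_iff supp_def unit_vec_def)
  ultimately show ?thesis
    using assms eval_ind_poly[OF u assms] by (simp add: supp_def unit_vec_def)
qed

end

section \<open>Hilbert function and regularity\<close>

lemma vanishing_ideal_graded_iff:
  assumes "f \<in> graded_part n D"
  shows "f \<in> vanishing_ideal n Xs \<longleftrightarrow> (\<forall>P\<in>Xs. vanishes_at f P)"
  using assms graded_part_subset_polys[of n D]
  by (auto simp: vanishing_ideal_eq line_poly_graded vanishes_at_def)

lemma finite_nonzero_vecs: "finite (nonzero_vecs n :: (nat \<Rightarrow> 'a::{zero,finite}) set)"
proof (rule finite_subset)
  show "nonzero_vecs n \<subseteq> {a :: nat \<Rightarrow> 'a. \<forall>i. (i \<in> {..n} \<longrightarrow> a i \<in> UNIV) \<and> (i \<notin> {..n} \<longrightarrow> a i = 0)}"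
    by (auto simp: nonzero_vecs_def)
qed (intro finite_set_of_finite_funs; simp)

lemma finite_proj_space: "finite (proj_space n :: (nat \<Rightarrow> 'a::{field,finite}) set set)"
  by (simp add: proj_space_eq finite_nonzero_vecs)

section \<open>The evaluation map on forms of a fixed degree\<close>

locale finite_point_set =
  fixes n :: nat and Xs :: "(nat \<Rightarrow> 'a::{field,finite}) set set"
  assumes Xs: "Xs \<subseteq> proj_space n"
begin

lemma finite_Xs: "finite Xs"
  using Xs finite_proj_space by (rule finite_subset)

definition rep :: "(nat \<Rightarrow> 'a) set \<Rightarrow> nat \<Rightarrow> 'a" where
  "rep P = (SOME a. a \<in> P)"

lemma rep_mem: "P \<in> Xs \<Longrightarrow> rep P \<in> P"
  unfolding rep_def using Xs proj_space_nonempty by (metis someI subsetD)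

lemma vanishes_at_rep:
  "f \<in> graded_part n D \<Longrightarrow> P \<in> Xs \<Longrightarrow> vanishes_at f P \<longleftrightarrow> eval_mpoly f (rep P) = 0"
  using vanishes_at_iff rep_mem Xs by blast

definition evals :: "'a mpoly \<Rightarrow> (nat \<Rightarrow> 'a) set \<Rightarrow> 'a" where
  "evals f = (\<lambda>P\<in>Xs. eval_mpoly f (rep P))"

lemma evals_eq_iff: "evals f = evals g \<longleftrightarrow> (\<forall>P\<in>Xs. eval_mpoly f (rep P) = eval_mpoly g (rep P))"
  unfolding evals_def by (auto simp: fun_eq_iff)

context
  fixes D :: nat
begin

abbreviation (input) "V \<equiv> graded_part n D :: 'a mpoly set"
abbreviation (input) "W \<equiv> vanishing_ideal n Xs \<inter> V"

lemma graded_comb: "B \<subseteq> V \<Longrightarrow> (\<Sum>b\<in>B. Const (c b) * b) \<in> V"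
  by (intro graded_part_sum graded_part_Const_mult) auto

lemma diff_mem_W_iff:
  assumes "f \<in> V" "g \<in> V"
  shows "f - g \<in> W \<longleftrightarrow> evals f = evals g"
proof -
  have fg: "f - g \<in> V"
    using assms by (rule graded_part_diff)
  then show ?thesis
    using vanishing_ideal_graded_iff[OF fg] vanishes_at_rep[OF fg] by (simp add: evals_eq_iff)
qed

lemma mem_W_iff:
  assumes "f \<in> V"
  shows "f \<in> W \<longleftrightarrow> (\<forall>P\<in>Xs. eval_mpoly f (rep P) = 0)"
  using diff_mem_W_iff[OF assms graded_part_zero] by (simp add: evals_eq_iff)

text \<open>Evaluation embeds the quotient \<open>V / W\<close> into the functions on the points.
  Since the field is finite, the size of the image determines the size of any basis.\<close>

lemma card_evals_image:
  assumes B: "quot_basis V W B"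
  shows "card (evals ` V) = card (UNIV :: 'a set) ^ card B"
proof -
  let ?s = "\<lambda>c. \<Sum>b\<in>B. Const (c b) * b"
  have B': "finite B" "B \<subseteq> V"
      "\<And>c b. ?s c \<in> W \<Longrightarrow> b \<in> B \<Longrightarrow> c b = 0" "\<And>v. v \<in> V \<Longrightarrow> \<exists>c. v - ?s c \<in> W"
    using B unfolding quot_basis_def by blast+
  have "bij_betw (\<lambda>c. evals (?s c)) (Pi\<^sub>E B (\<lambda>_. UNIV)) (evals ` V)"
    unfolding bij_betw_def
  proof
    show "inj_on (\<lambda>c. evals (?s c)) (Pi\<^sub>E B (\<lambda>_. UNIV))"
    proof (rule inj_onI)
      fix c c' assume c: "c \<in> Pi\<^sub>E B (\<lambda>_. UNIV)" "c' \<in> Pi\<^sub>E B (\<lambda>_. UNIV)"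
        and eq: "evals (?s c) = evals (?s c')"
      have "?s (\<lambda>b. c b - c' b) \<in> W"
        unfolding mem_W_iff[OF graded_comb[OF B'(2)]] using eq
        by (simp add: evals_eq_iff left_diff_distrib sum_subtractf)
      then have "c b = c' b" if "b \<in> B" for b
        using B'(3)[of "\<lambda>b. c b - c' b"] that by simp
      then show "c = c'"
        using c by (rule PiE_ext[rotated 2])
    qed
    show "(\<lambda>c. evals (?s c)) ` Pi\<^sub>E B (\<lambda>_. UNIV) = evals ` V"
    proof
      show "(\<lambda>c. evals (?s c)) ` Pi\<^sub>E B (\<lambda>_. UNIV) \<subseteq> evals ` V"
        using graded_comb[OF B'(2)] by blast
      show "evals ` V \<subseteq> (\<lambda>c. evals (?s c)) ` Pi\<^sub>E B (\<lambda>_. UNIV)"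
      proof
        fix u assume "u \<in> evals ` V"
        then obtain v where v: "v \<in> V" "u = evals v"
          by blast
        then obtain c where "v - ?s c \<in> W"
          using B'(4) by blast
        then have "u = evals (?s c)"
          using diff_mem_W_iff[OF v(1) graded_comb[OF B'(2)]] v by blast
        also have "?s c = ?s (restrict c B)"
          by (intro sum.cong) auto
        finally show "u \<in> (\<lambda>c. evals (?s c)) ` Pi\<^sub>E B (\<lambda>_. UNIV)"
          by (intro image_eqI[of _ _ "restrict c B"]) simp_all
      qed
    qed
  qed
  then have "card (evals ` V) = card (Pi\<^sub>E B (\<lambda>_. UNIV :: 'a set))"
    by (rule bij_betw_same_card[symmetric])
  then show ?thesis
    using B'(1) by (simp add: card_PiE)
qed

text \<open>One preimage for each of the finitely many evaluation vectors gives a finite spanning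
  set, and a spanning set of least cardinality is independent.\<close>

lemma quot_basis_exists: "\<exists>B. quot_basis V W B"
proof -
  let ?s = "\<lambda>B c. \<Sum>b\<in>B. Const (c b) * b"
  define spans where "spans B \<longleftrightarrow> finite B \<and> B \<subseteq> V \<and> (\<forall>v\<in>V. \<exists>c. v - ?s B c \<in> W)" for B
  have "evals ` V \<subseteq> Pi\<^sub>E Xs (\<lambda>_. UNIV)"
    by (auto simp: evals_def)
  then have fin: "finite (evals ` V)"
    using finite_Xs by (rule finite_subset[OF _ finite_PiE]) auto
  define p where "p u = (SOME v. v \<in> V \<and> evals v = u)" for u
  have p: "p u \<in> V" "evals (p u) = u" if "u \<in> evals ` V" for u
    using someI_ex[of "\<lambda>v. v \<in> V \<and> evals v = u"] that unfolding p_def by blast+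
  have "spans (p ` evals ` V)"
    unfolding spans_def
  proof (intro conjI ballI)
    fix v assume v: "v \<in> V"
    let ?w = "p (evals v)"
    have "(\<Sum>b\<in>p ` evals ` V. Const (if b = ?w then 1 else 0) * b) =
        (\<Sum>b\<in>p ` evals ` V. if b = ?w then ?w else 0)"
      by (intro sum.cong) (auto simp: Const_def)
    also have "\<dots> = ?w"
      using v fin by simp
    finally have "v - ?s (p ` evals ` V) (\<lambda>b. if b = ?w then 1 else 0) \<in> W"
      using diff_mem_W_iff[OF v p(1)] p(2) v by simp
    then show "\<exists>c. v - ?s (p ` evals ` V) c \<in> W"
      by (rule exI[of _ "\<lambda>b. if b = ?w then 1 else 0"])
  qed (use fin p in auto)
  then obtain B where B: "spans B" "\<And>B'. spans B' \<Longrightarrow> card B \<le> card B'"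
    using ex_has_least_nat[of spans _ card] by blast
  have BV: "finite B" "B \<subseteq> V"
    using B(1) by (auto simp: spans_def)
  have "c b0 = 0" if c: "?s B c \<in> W" and b0: "b0 \<in> B" for c b0
  proof (rule ccontr)
    assume nz: "c b0 \<noteq> 0"
    have "spans (B - {b0})"
      unfolding spans_def
    proof (intro conjI ballI)
      fix v assume v: "v \<in> V"
      then obtain e where e: "v - ?s B e \<in> W"
        using B(1) by (auto simp: spans_def)
      define e' where "e' b = e b - e b0 / c b0 * c b" for b
      have *: "(\<Sum>b\<in>B - {b0}. e' b * eval_mpoly b a) = (\<Sum>b\<in>B. e' b * eval_mpoly b a)" for a
        using BV b0 nz by (simp add: sum.remove e'_def)
      have "(\<Sum>b\<in>B. e' b * eval_mpoly b a) = (\<Sum>b\<in>B. e b * eval_mpoly b a) -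
          e b0 / c b0 * (\<Sum>b\<in>B. c b * eval_mpoly b a)" for a
        by (simp add: e'_def left_diff_distrib sum_subtractf sum_distrib_left mult.assoc)
      then have "evals (?s (B - {b0}) e') = evals (?s B e)"
        using c unfolding mem_W_iff[OF graded_comb[OF BV(2)]] evals_eq_iff by (simp add: *)
      then have "v - ?s (B - {b0}) e' \<in> W"
        using e v BV by (subst diff_mem_W_iff; (subst (asm) diff_mem_W_iff)?)
          (auto intro!: graded_comb)
      then show "\<exists>c. v - ?s (B - {b0}) c \<in> W"
        by (rule exI[of _ e'])
    qed (use BV in auto)
    then show False
      using B(2)[of "B - {b0}"] BV(1) b0 by (meson card_Diff1_less leD)
  qed
  then have "quot_basis V W B"
    using B(1) unfolding quot_basis_def spans_def by blast
  then show ?thesis ..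
qed

lemma hilbert_fun_power: "card (evals ` V) = card (UNIV :: 'a set) ^ hilbert_fun n Xs D"
  unfolding hilbert_fun_def quot_dim_def
  by (rule card_evals_image) (rule someI_ex[OF quot_basis_exists])

text \<open>Counting turns the equality into surjectivity of evaluation, that is, into attaining a
  nonzero multiple of the characteristic function of each point.\<close>

lemma hilbert_fun_eq_card_iff:
  "hilbert_fun n Xs D = card Xs \<longleftrightarrow> (\<forall>P\<in>Xs. \<exists>f\<in>V. indicator_function n Xs P f)"
proof -
  let ?U = "Pi\<^sub>E Xs (\<lambda>_. UNIV :: 'a set)"
  have sub: "evals ` V \<subseteq> ?U"
    by (auto simp: evals_def)
  have fin: "finite ?U"
    using finite_Xs by (intro finite_PiE) auto
  have card_U: "card ?U = card (UNIV :: 'a set) ^ card Xs"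
    using finite_Xs by (simp add: card_PiE)
  have "card (UNIV :: 'a set) > 1"
    using card_mono[of UNIV "{0, 1 :: 'a}"] by simp
  then have "hilbert_fun n Xs D = card Xs \<longleftrightarrow> card (evals ` V) = card ?U"
    unfolding hilbert_fun_power card_U by simp
  also have "\<dots> \<longleftrightarrow> evals ` V = ?U"
    using card_subset_eq[OF fin sub] by auto
  also have "\<dots> \<longleftrightarrow> (\<forall>P\<in>Xs. \<exists>f\<in>V. indicator_function n Xs P f)"
  proof
    assume eq: "evals ` V = ?U"
    show "\<forall>P\<in>Xs. \<exists>f\<in>V. indicator_function n Xs P f"
    proof
      fix P assume P: "P \<in> Xs"
      have "(\<lambda>Q\<in>Xs. if Q = P then 1 else 0) \<in> evals ` V"
        unfolding eq by auto
      then obtain f where f: "f \<in> V" "evals f = (\<lambda>Q\<in>Xs. if Q = P then 1 else 0)"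
        by (rule imageE) (rule that, simp_all)
      have "eval_mpoly f (rep Q) = (if Q = P then 1 else 0)" if "Q \<in> Xs" for Q
        using fun_cong[OF f(2), of Q] that by (simp add: evals_def)
      then have "indicator_function n Xs P f"
        using f(1) P vanishes_at_rep[OF f(1)] by (auto simp: indicator_function_def homogeneous_def)
      then show "\<exists>f\<in>V. indicator_function n Xs P f"
        using f(1) by blast
    qed
  next
    assume "\<forall>P\<in>Xs. \<exists>f\<in>V. indicator_function n Xs P f"
    then obtain f where f: "\<And>P. P \<in> Xs \<Longrightarrow> f P \<in> V" "\<And>P. P \<in> Xs \<Longrightarrow> indicator_function n Xs P (f P)"
      by metis
    have eval_f: "eval_mpoly (f P) (rep Q) = 0 \<longleftrightarrow> Q \<noteq> P" if "P \<in> Xs" "Q \<in> Xs" for P Q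
      using f(2)[OF that(1)] vanishes_at_rep[OF f(1)[OF that(1)]] that
      by (auto simp: indicator_function_def)
    have "u \<in> evals ` V" if u: "u \<in> ?U" for u
    proof
      \<comment> \<open>Lagrange interpolation, with the indicator functions normalized to have
        value 1 at the chosen representatives.\<close>
      let ?v = "\<Sum>P\<in>Xs. Const (u P / eval_mpoly (f P) (rep P)) * f P"
      show "?v \<in> V"
        using f(1) by (intro graded_part_sum graded_part_Const_mult)
      show "u = evals ?v"
      proof
        fix Q
        show "u Q = evals ?v Q"
        proof (cases "Q \<in> Xs")
          case True
          have "eval_mpoly ?v (rep Q) = (\<Sum>P\<in>Xs. if P = Q then u Q else 0)"
            unfolding eval_mpoly_sum using True eval_f by (intro sum.cong) auto
          then show ?thesis
            using True finite_Xs by (simp add: evals_def)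
        next
          case False
          then show ?thesis
            using u by (auto simp: evals_def)
        qed
      qed
    qed
    then show "evals ` V = ?U"
      using sub by blast
  qed
  finally show ?thesis .
qed

end

end

section \<open>Indicator functions for the points of the tower and the regularity\<close>

context subfield_tower
begin

abbreviation Xs :: "(nat \<Rightarrow> 'a) set set" where "Xs \<equiv> proj_product n F"

lemma Xs_subset: "Xs \<subseteq> proj_space n"
  by (auto simp: proj_product_def)

sublocale finite_point_set n Xs
  by unfold_locales (rule Xs_subset)

lemma tower_vecs_nonzero: "a \<in> tower_vecs \<Longrightarrow> a \<in> nonzero_vecs n"
  by (simp add: tower_vecs_def)

lemma Xs_eq: "Xs = proj_pt n ` tower_vecs"
proof -
  have "P \<in> proj_pt n ` tower_vecs" if "P \<in> Xs" for P
    using that proj_space_cases unfolding proj_product_def tower_vecs_def by blast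
  moreover have "proj_pt n a \<in> Xs" if "a \<in> tower_vecs" for a
    using that mem_proj_pt[of a n] unfolding proj_product_def tower_vecs_def proj_space_eq by blast
  ultimately show ?thesis
    by blast
qed

lemma indicator_iff:
  assumes f: "f \<in> graded_part n D" and a: "a \<in> tower_vecs"
  shows "indicator_function n Xs (proj_pt n a) f \<longleftrightarrow>
    eval_mpoly f a \<noteq> 0 \<and> (\<forall>b\<in>tower_vecs. b \<notin> proj_pt n a \<longrightarrow> eval_mpoly f b = 0)"
proof -
  have van: "vanishes_at f (proj_pt n b) \<longleftrightarrow> eval_mpoly f b = 0" if "b \<in> tower_vecs" for b
    using tower_vecs_nonzero[OF that] mem_proj_pt
    by (intro vanishes_at_iff[OF f]) (auto simp: proj_space_eq)
  have "proj_pt n b = proj_pt n a \<longleftrightarrow> b \<in> proj_pt n a" if "b \<in> tower_vecs" for b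
    using tower_vecs_nonzero[OF that] tower_vecs_nonzero[OF a] mem_proj_pt proj_pt_eqI by blast
  then have "(\<forall>Q\<in>Xs - {proj_pt n a}. vanishes_at f Q) \<longleftrightarrow>
      (\<forall>b\<in>tower_vecs. b \<notin> proj_pt n a \<longrightarrow> eval_mpoly f b = 0)"
    using van unfolding Xs_eq by (auto simp: Ball_def)
  then show ?thesis
    using f van[OF a] unfolding indicator_function_def homogeneous_def by blast
qed

lemma unit_vec_tower:
  assumes "j \<le> n"
  shows "unit_vec j \<in> tower_vecs"
  using assms zero_in_F one_in_F unfolding tower_vecs_def nonzero_vecs_def unit_vec_def
  by (auto intro!: exI[of _ j])

lemma mem_proj_pt_unit_vec_iff:
  fixes b :: "nat \<Rightarrow> 'a"
  assumes "j \<le> n" "b \<in> nonzero_vecs n"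
  shows "b \<in> proj_pt n (unit_vec j) \<longleftrightarrow> (\<forall>i\<le>n. i \<noteq> j \<longrightarrow> b i = 0)"
proof
  assume "b \<in> proj_pt n (unit_vec j)"
  then show "\<forall>i\<le>n. i \<noteq> j \<longrightarrow> b i = 0"
    unfolding proj_pt_eq[OF tower_vecs_nonzero[OF unit_vec_tower[OF assms(1)]]]
    by (auto simp: unit_vec_def)
next
  assume *: "\<forall>i\<le>n. i \<noteq> j \<longrightarrow> b i = 0"
  then have "b = (\<lambda>i. b j * unit_vec j i)"
    using assms by (auto simp: unit_vec_def nonzero_vecs_def fun_eq_iff) (meson not_le)
  moreover have "b j \<noteq> 0"
    using * assms(2) by (auto simp: nonzero_vecs_def)
  ultimately show "b \<in> proj_pt n (unit_vec j)"
    unfolding proj_pt_eq[OF tower_vecs_nonzero[OF unit_vec_tower[OF assms(1)]]] by blast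
qed

lemma indicator_ind_poly:
  assumes "1 \<le> n" "j \<le> n"
  shows "indicator_function n Xs (proj_pt n (unit_vec j)) (ind_poly n d j)"
  unfolding indicator_iff[OF graded_ind_poly[OF assms] unit_vec_tower[OF assms(2)]]
proof (intro conjI ballI impI)
  show "eval_mpoly (ind_poly n d j) (unit_vec j) \<noteq> (0 :: 'a)"
    by (rule eval_ind_poly_unit_vec[OF assms(2)])
  fix b assume b: "b \<in> tower_vecs" "b \<notin> proj_pt n (unit_vec j)"
  then obtain i where "i \<le> n" "i \<noteq> j" "b i \<noteq> 0"
    using mem_proj_pt_unit_vec_iff[OF assms(2) tower_vecs_nonzero] by blast
  then show "eval_mpoly (ind_poly n d j) b = 0"
    using b(1) assms by (intro eval_ind_poly_eq_0[of b j i]) (auto simp: tower_vecs_def)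
qed

lemma indicator_degree_ge:
  assumes "1 \<le> n" "j \<le> n" and g: "g \<in> graded_part n D"
    and ind: "indicator_function n Xs (proj_pt n (unit_vec j)) g"
  shows "ind_deg j \<le> D"
proof -
  note u = unit_vec_tower[OF assms(2)]
  have nz: "eval_mpoly g (unit_vec j) \<noteq> 0"
    and "\<And>b. b \<in> tower_vecs \<Longrightarrow> b \<notin> proj_pt n (unit_vec j) \<Longrightarrow> eval_mpoly g b = 0"
    using ind unfolding indicator_iff[OF g u] by blast+
  then have zero: "eval_mpoly g a = 0" if "a \<in> tower_vecs" "i \<le> n" "i \<noteq> j" "a i \<noteq> 0" for a i
    using that mem_proj_pt_unit_vec_iff[OF assms(2) tower_vecs_nonzero] by blast
  \<comment> \<open>A form of degree 0 is constant, but since \<open>n \<ge> 1\<close> there is a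
    second unit point where \<open>g\<close> must vanish.\<close>
  have "D \<noteq> 0"
  proof
    assume "D = 0"
    then have const: "eval_mpoly g a = eval_mpoly g (\<lambda>_. 0)" for a
      using eval_mpoly_scale[OF g, of 0 a] by simp
    obtain i where i: "i \<le> n" "i \<noteq> j"
      using assms(1) by (metis le0 zero_neq_one)
    have "eval_mpoly g (unit_vec i) = 0"
      using i by (intro zero[OF unit_vec_tower]) (auto simp: unit_vec_def)
    then show False
      using nz const by metis
  qed
  then show ?thesis
    using degree_ge_0[OF g _ assms(2) nz zero] degree_ge[OF g _ assms(2) nz zero]
    by (cases "j = 0") (auto simp: ind_deg_def)
qed

text \<open>If \<open>a\<^sub>k\<close> is the first nonzero coordinate of \<open>a\<close>, then the substitution
  \<open>t\<^sub>i \<mapsto> t\<^sub>i - (a\<^sub>i / a\<^sub>k) t\<^sub>k\<close> for \<open>i > k\<close> preserves the set of points, because the fields increase,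
  and moves \<open>a\<close> to a multiple of the \<open>k\<close>-th unit vector.\<close>

lemma indicator_exists:
  assumes "1 \<le> n" "P \<in> Xs" and D: "1 + (\<Sum>i=1..n. d i - 1) \<le> D"
  shows "\<exists>f\<in>graded_part n D. indicator_function n Xs P f"
proof -
  obtain a where a: "a \<in> tower_vecs" "P = proj_pt n a"
    using assms(2) unfolding Xs_eq by blast
  define k where "k = (LEAST k. a k \<noteq> 0)"
  obtain k' where k': "k' \<le> n" "a k' \<noteq> 0"
    using tower_vecs_nonzero[OF a(1)] by (auto simp: nonzero_vecs_def)
  have ak: "a k \<noteq> 0" and k: "k \<le> n"
    using LeastI[of "\<lambda>k. a k \<noteq> 0", OF k'(2)] Least_le[of "\<lambda>k. a k \<noteq> 0", OF k'(2)] k'(1)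
    unfolding k_def by auto
  have a_less: "a i = 0" if "i < k" for i
    using not_less_Least[of i "\<lambda>k. a k \<noteq> 0"] that unfolding k_def by blast
  define h where "h i = (if k < i then Var i - Const (a i / a k) * Var k else Var i)" for i
  define s where "s b i = (if k < i then b i - a i / a k * b k else b i)" for b and i :: nat
  have h: "h i \<in> graded_part n 1" if "i \<le> n" for i
    unfolding h_def using that k
    by (auto intro!: graded_part_diff graded_part_Const_mult graded_part_Var simp del: One_nat_def)
  have eval_h: "(\<lambda>i. eval_mpoly (h i) b) = s b" for b
    by (auto simp: h_def s_def)
  obtain g where g: "g \<in> graded_part n (ind_deg k)"
      "\<And>b. eval_mpoly g b = eval_mpoly (ind_poly n d k) (s b)"
    using graded_part_substitute[OF graded_ind_poly[OF assms(1) k], of h, OF h] unfolding eval_h by blast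
  have "s a = (\<lambda>i. a k * unit_vec k i)"
    using a_less ak by (auto simp: s_def unit_vec_def)
  then have ga: "eval_mpoly g a \<noteq> 0"
    using g(2) ak eval_ind_poly_unit_vec[OF k] eval_mpoly_scale[OF graded_ind_poly[OF assms(1) k]]
    by simp
  have gb: "eval_mpoly g b = 0" if b: "b \<in> tower_vecs" "b \<notin> P" for b
  proof -
    have "s b i \<in> F i" if i: "i \<le> n" for i
    proof -
      have "a i \<in> F i" "b i \<in> F i"
        using a b i by (auto simp: tower_vecs_def)
      moreover have "a k \<in> F i" "b k \<in> F i" if "k < i"
        using that i k a b F_mono[of k i] by (auto simp: tower_vecs_def)
      ultimately show ?thesis
        unfolding s_def using subfield_F[OF i]
        by (auto intro!: subfield_diff subfield_mult subfield_divide)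
    qed
    \<comment> \<open>If only coordinate \<open>k\<close> of \<open>s b\<close> survived, undoing
      the substitution would make \<open>b\<close> a multiple of \<open>a\<close>.\<close>
    moreover have "\<exists>i\<le>n. i \<noteq> k \<and> s b i \<noteq> 0"
    proof (rule ccontr)
      assume "\<not> ?thesis"
      then have sb: "s b i = 0" if "i \<le> n" "i \<noteq> k" for i
        using that by blast
      have eq: "b i = b k / a k * a i" for i
      proof (cases "i \<le> n")
        case True
        then show ?thesis
          using sb[of i] a_less[of i] ak by (cases i k rule: linorder_cases) (auto simp: s_def)
      next
        case False
        then show ?thesis
          using tower_vecs_nonzero[OF a(1)] tower_vecs_nonzero[OF b(1)] by (simp add: nonzero_vecs_def)
      qed
      then have b_eq: "b = (\<lambda>i. b k / a k * a i)"
        by (rule ext)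
      have "b k \<noteq> 0"
      proof
        assume "b k = 0"
        then have "b i = 0" for i
          using eq[of i] by simp
        then show False
          using tower_vecs_nonzero[OF b(1)] by (simp add: nonzero_vecs_def)
      qed
      then have "b k / a k \<noteq> 0"
        using ak by simp
      then have "b \<in> proj_pt n a"
        unfolding proj_pt_eq[OF tower_vecs_nonzero[OF a(1)]] using b_eq by blast
      then show False
        using b a by simp
    qed
    ultimately show ?thesis
      unfolding g(2) using k by (metis eval_ind_poly_eq_0)
  qed
  \<comment> \<open>The power of \<open>t_k\<close> fills up the degree and is nonzero at
    \<open>a\<close>.\<close>
  let ?f = "g * Var k ^ (D - ind_deg k)"
  have f: "?f \<in> graded_part n D"
    using ind_deg_le[OF k] D by (intro graded_part_mult'[OF g(1) graded_part_Var_power[OF k]]) simp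
  moreover have "indicator_function n Xs P ?f"
    unfolding a(2) indicator_iff[OF f a(1)] using ga gb ak a(2) by simp
  ultimately show ?thesis
    by blast
qed

text \<open>From this degree on all points have indicator functions. One degree lower,
  \<open>[e_0]\<close> has none, so the equality with the number of points fails there.\<close>

lemma hilbert_reg_eq:
  assumes "1 \<le> n"
  shows "hilbert_reg n Xs = 1 + (\<Sum>i=1..n. d i - 1)"
  unfolding hilbert_reg_def
proof (rule Least_equality)
  show "\<forall>D\<ge>1 + (\<Sum>i=1..n. d i - 1). hilbert_fun n Xs D = card Xs"
    using indicator_exists[OF assms] by (auto simp: hilbert_fun_eq_card_iff)
  fix r assume r: "\<forall>D\<ge>r. hilbert_fun n Xs D = card Xs"
  show "1 + (\<Sum>i=1..n. d i - 1) \<le> r"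
  proof (rule ccontr)
    assume "\<not> ?thesis"
    then have "hilbert_fun n Xs (\<Sum>i=1..n. d i - 1) = card Xs"
      using r by simp
    moreover have "proj_pt n (unit_vec 0) \<in> Xs"
      unfolding Xs_eq using unit_vec_tower by blast
    ultimately obtain g where "g \<in> graded_part n (\<Sum>i=1..n. d i - 1)"
        "indicator_function n Xs (proj_pt n (unit_vec 0)) g"
      unfolding hilbert_fun_eq_card_iff by blast
    then have "ind_deg 0 \<le> (\<Sum>i=1..n. d i - 1)"
      using assms by (intro indicator_degree_ge) auto
    then show False
      by (simp add: ind_deg_def)
  qed
qed

lemma total_deg_indicator:
  assumes "g \<in> graded_part n D" "indicator_function n Xs P g"
  shows "total_deg g = D"
proof (rule total_deg_graded[OF assms(1)])
  show "g \<noteq> 0"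
    using assms(2) by (auto simp: indicator_function_def vanishes_at_def)
qed

end

theorem theorem4p9:
  fixes F :: "nat \<Rightarrow> 'a::{field, finite} set" and n j :: nat
  assumes "n \<ge> 1"
    and "\<And>i. i \<le> n \<Longrightarrow> subfield (F i) (ring_of_type_algebra :: 'a ring)"
    and "\<And>i. i < n \<Longrightarrow> F i \<subseteq> F (Suc i)"
    and "j \<le> n"
  shows "let d = (\<lambda>i. card (F i));
             Xs = proj_product n F;
             P = proj_pt n (unit_vec j);
             f = ind_poly n d j
         in P \<in> Xs
          \<and> indicator_function n Xs P f
          \<and> (\<forall>g. indicator_function n Xs P g \<longrightarrow> total_deg f \<le> total_deg g)
          \<and> local_v_number n Xs P = total_deg f
          \<and> (j \<in> {0, 1} \<longrightarrow> total_deg f = hilbert_reg n Xs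
                          \<and> hilbert_reg n Xs = 1 + (\<Sum>i=1..n. d i - 1))
          \<and> (j \<in> {2..n - 1} \<longrightarrow>
               total_deg f = m_exp d j * (d j - 1) + 1 + (\<Sum>i=j+1..n. d i - 1))
          \<and> (j = n \<longrightarrow> total_deg f = m_exp d n * (d n - 1) + 1)"
proof -
  interpret subfield_tower F n
    using assms(2,3) by (rule subfield_tower.intro)
  let ?P = "proj_pt n (unit_vec j) :: (nat \<Rightarrow> 'a) set" and ?f = "ind_poly n d j :: 'a mpoly"
  have P: "?P \<in> Xs"
    unfolding Xs_eq using unit_vec_tower[OF assms(4)] by blast
  note f = graded_ind_poly[OF assms(1,4)] and ind = indicator_ind_poly[OF assms(1,4)]
  have deg: "total_deg ?f = ind_deg j"
    by (rule total_deg_indicator[OF f ind])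
  have ge: "ind_deg j \<le> D" if "g \<in> graded_part n D" "indicator_function n Xs ?P g" for g D
    using that by (rule indicator_degree_ge[OF assms(1,4)])
  have min: "ind_deg j \<le> total_deg g" if g: "indicator_function n Xs ?P g" for g
  proof -
    obtain D where "g \<in> graded_part n D"
      using g by (auto simp: indicator_function_def homogeneous_def)
    then show ?thesis
      using ge g total_deg_indicator by blast
  qed
  have v: "local_v_number n Xs ?P = ind_deg j"
    unfolding local_v_number_eq_Least[OF Xs_subset P ind]
    by (rule Least_equality) (use f ind ge in blast)+
  have "ind_deg j = 1 + (\<Sum>i=1..n. d i - 1)" if "j \<in> {0, 1}"
    using that ind_deg_1[OF assms(1)] by (auto simp: ind_deg_def)
  then show ?thesis
    unfolding Let_def deg v hilbert_reg_eq[OF assms(1)]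
    using P ind min assms(1) by (auto simp: ind_deg_def)
qed

end
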